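(* Let $f\in\mathscr{D}'(\mathbb{R}^d)$ and $(x_0,\xi_0)\in\mathbb{R}^d\times(\mathbb{R}^d\setminus\{0\})$. The following conditions are equivalent: (i) There exist $\varepsilon\in(0,1)$, a function $\phi\in\mathscr{D}(I_{\varepsilon,x_0})$ with $\phi\equiv 1$ in a neighborhood of $x_0$, and an open cone $\Gamma\subset\mathbb{R}^d$ containing $\xi_0$ such that $$(\forall N\in\mathbb{N})(\exists C_N>0)(\forall n\in\Gamma\cap\mathbb{Z}^d)\quad |\widehat{f\phi}(n)|\leq C_N\langle n\rangle^{-N}.$$ (ii) $(x_0,\xi_0)\notin WF(f)$.
   Context: For $x\in\mathbb{R}^d$, $|x|$ is the Euclidean norm and $\langle x\rangle=(1+|x|^2)^{1/2}$. For $0<\eta\leq 1$ and $x\in\mathbb{R}^d$, $I_{\eta,x}=\prod_{j=1}^d(x_j-\eta/2,x_j+\eta/2)$. $\mathscr{D}(\Omega)$ is the space of smooth functions with compact support in the open set $\Omega$, and $\mathscr{D}'(\mathbb{R}^d)$ is the space of distributions. A cone is a subset of $\mathbb{R}^d$ invariant under multiplication by positive scalars. The Fourier transform of a compactly supported distribution $g$ is the smooth function $\widehat{g}(\xi)=\langle g(x),e^{-2\pi i\xi\cdot x}\rangle$, $\xi\in\mathbb{R}^d$. (For $n\in\mathbb{Z}^d$ and $g$ with support in $I_{\eta,x_0}$, $0<\eta<1$, $\widehat{g}(n)$ is the $n$-th Fourier coefficient of the 1-periodic extension $\sum_{m\in\mathbb{Z}^d}g(\cdot+m)$.) Definition of the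 wave front set: for $f\in\mathscr{D}'(\mathbb{R}^d)$ and $(x_0,\xi_0)\in\mathbb{R}^d\times(\mathbb{R}^d\setminus\{0\})$, one has $(x_0,\xi_0)\notin WF(f)$ if there exist $\psi\in\mathscr{D}(\mathbb{R}^d)$ with $\psi\equiv 1$ in a neighborhood of $x_0$ and an open cone $\Gamma\subset\mathbb{R}^d$ containing $\xi_0$ such that $$(\forall N>0)(\exists C_N>0)(\forall\xi\in\Gamma)\quad |\widehat{f\psi}(\xi)|\leq C_N\langle\xi\rangle^{-N}.$$ *)

theory Defs
  imports "HOL-Analysis.Analysis"
begin

section \<open>Smooth functions and test functions\<close>

definition partial_deriv :: "'d::finite \<Rightarrow> (real^'d \<Rightarrow> complex) \<Rightarrow> real^'d \<Rightarrow> complex" where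
  "partial_deriv j u = (\<lambda>x. frechet_derivative u (at x) (axis j 1))"

text \<open>Iterated partial derivatives are indexed by lists of coordinates. On smooth functions the order
  of differentiation is immaterial, so the lists of length \<open>m\<close> yield exactly the derivatives
  belonging to multi-indices of order \<open>m\<close>.\<close>

definition iter_deriv :: "'d::finite list \<Rightarrow> (real^'d \<Rightarrow> complex) \<Rightarrow> real^'d \<Rightarrow> complex" where
  "iter_deriv js u = foldr partial_deriv js u"

definition smooth :: "(real^'d::finite \<Rightarrow> complex) \<Rightarrow> bool" where
  "smooth u \<longleftrightarrow> (\<forall>js x. iter_deriv js u differentiable (at x))"

definition fun_support :: "(real^'d::finite \<Rightarrow> complex) \<Rightarrow> (real^'d) set" where
  "fun_support u = closure {x. u x \<noteq> 0}"

text \<open>Elements of \<open>\<D>(\<Omega>)\<close> are represented by their extension by zero to the whole space.\<close>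

definition test_functions :: "(real^'d::finite) set \<Rightarrow> (real^'d \<Rightarrow> complex) set" where
  "test_functions \<Omega> = {\<phi>. smooth \<phi> \<and> compact (fun_support \<phi>) \<and> fun_support \<phi> \<subseteq> \<Omega>}"

section \<open>Distributions\<close>

text \<open>A distribution is a functional on test functions; its values on other functions carry no meaning
  and are never used. Continuity is expressed by the usual seminorm estimates on each compact set.\<close>

type_synonym 'd functional = "(real^'d \<Rightarrow> complex) \<Rightarrow> complex"

definition distribution :: "'d::finite functional \<Rightarrow> bool" where
  "distribution f \<longleftrightarrow>
     (\<forall>\<phi>\<in>test_functions UNIV. \<forall>\<psi>\<in>test_functions UNIV. f (\<lambda>x. \<phi> x + \<psi> x) = f \<phi> + f \<psi>) \<and>
     (\<forall>c. \<forall>\<phi>\<in>test_functions UNIV. f (\<lambda>x. c * \<phi> x) = c * f \<phi>) \<and>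
     (\<forall>K. compact K \<longrightarrow> (\<exists>C k. \<forall>\<phi>\<in>test_functions UNIV. fun_support \<phi> \<subseteq> K \<longrightarrow>
        norm (f \<phi>) \<le> C * (\<Sum>js | length js \<le> k. SUP x. norm (iter_deriv js \<phi> x))))"

definition mult_distr :: "'d::finite functional \<Rightarrow> (real^'d \<Rightarrow> complex) \<Rightarrow> 'd functional" where
  "mult_distr f \<psi> = (\<lambda>\<phi>. f (\<lambda>x. \<psi> x * \<phi> x))"

definition distr_support :: "'d::finite functional \<Rightarrow> (real^'d) set" where
  "distr_support g = - \<Union>{U. open U \<and> (\<forall>\<phi>\<in>test_functions U. g \<phi> = 0)}"

definition cutoff_for :: "(real^'d::finite) set \<Rightarrow> (real^'d \<Rightarrow> complex) \<Rightarrow> bool" where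
  "cutoff_for K \<kappa> \<longleftrightarrow> \<kappa> \<in> test_functions UNIV \<and> (\<exists>U. open U \<and> K \<subseteq> U \<and> (\<forall>x\<in>U. \<kappa> x = 1))"

text \<open>Pairing of a compactly supported distribution with a smooth function that need not have compact
  support. For such distributions the value does not depend on the cutoff.\<close>

definition pairing :: "'d::finite functional \<Rightarrow> (real^'d \<Rightarrow> complex) \<Rightarrow> complex" where
  "pairing g u = g (\<lambda>x. (SOME \<kappa>. cutoff_for (distr_support g) \<kappa>) x * u x)"

definition fourier :: "'d::finite functional \<Rightarrow> real^'d \<Rightarrow> complex" where
  "fourier g \<xi> = pairing g (\<lambda>x. exp (- 2 * of_real pi * \<i> * of_real (\<xi> \<bullet> x)))"

section \<open>The wave front set\<close>

definition bracket :: "real^'d::finite \<Rightarrow> real" where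
  "bracket x = sqrt (1 + (norm x)\<^sup>2)"

text \<open>Unlike the library's \<^const>\<open>cone\<close> and \<^const>\<open>conic\<close>, only positive scalars are used, so a
  cone need not contain the origin. (An open \<^const>\<open>cone\<close> is empty or the whole space.)\<close>

definition positive_cone :: "(real^'d::finite) set \<Rightarrow> bool" where
  "positive_cone \<Gamma> \<longleftrightarrow> (\<forall>x\<in>\<Gamma>. \<forall>t>0. t *\<^sub>R x \<in> \<Gamma>)"

definition cube :: "real \<Rightarrow> real^'d::finite \<Rightarrow> (real^'d) set" where
  "cube \<eta> x = {y. \<forall>j. x $ j - \<eta> / 2 < y $ j \<and> y $ j < x $ j + \<eta> / 2}"

definition integer_points :: "(real^'d::finite) set" where
  "integer_points = {n. \<forall>j. n $ j \<in> \<int>}"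

definition WF :: "'d::finite functional \<Rightarrow> ((real^'d) \<times> (real^'d)) set" where
  "WF f = {(x\<^sub>0, \<xi>\<^sub>0). \<xi>\<^sub>0 \<noteq> 0 \<and>
     \<not> (\<exists>\<psi> \<Gamma>. \<psi> \<in> test_functions UNIV \<and> (\<forall>\<^sub>F x in nhds x\<^sub>0. \<psi> x = 1) \<and>
          open \<Gamma> \<and> positive_cone \<Gamma> \<and> \<xi>\<^sub>0 \<in> \<Gamma> \<and>
          (\<forall>N>0::real. \<exists>C>0. \<forall>\<xi>\<in>\<Gamma>.
             norm (fourier (mult_distr f \<psi>) \<xi>) \<le> C * bracket \<xi> powr (- N)))}"

end

theory Submission
  imports Defs
begin

text \<open>A test function supported in an open cube of side \<open>L\<close> is the sum of its Fourier series with
  frequencies in \<open>(1/L)\<int>\<^sup>d\<close>. Expand \<open>\<theta>(x) exp(-2\<pi>i \<xi>\<cdot>x)\<close> in this way: for \<open>\<psi>\<close>, \<open>\<theta>\<close> supported in the cube, the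
  Fourier transform of \<open>f\<psi>\<theta>\<close> at an arbitrary real \<open>\<xi>\<close> is a sum, over lattice frequencies \<open>\<eta>\<close>, of the
  Fourier transform of \<open>f\<psi>\<close> at \<open>\<eta>\<close> weighted by the rapidly decreasing factor \<open>\<theta>^(\<xi> - \<eta>)\<close>. Splitting the
  sum according to whether \<open>\<eta>\<close> lies in the cone, rapid decay of the transform of \<open>f\<psi>\<close> on the lattice
  points of a cone passes to rapid decay of that of \<open>f\<psi>\<theta>\<close> on all of a smaller cone. For (i) to (ii)
  take \<open>L = 1\<close>, \<open>\<psi> = \<phi>\<close> and \<open>\<theta> = 1\<close> on the support of \<open>\<phi>\<close>; for (ii) to (i) take \<open>L\<close> large and
  \<open>\<theta> = \<phi>\<close> a bump function supported where \<open>\<psi> = 1\<close>.\<close>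

section \<open>Smooth functions\<close>

text \<open>Two obstacles shape the proof. A Fourier series reproduces a test function only on its
  cube and repeats it periodically elsewhere, so it can be inserted into f only behind a factor
  \<psi> supported in that cube; hence the estimates for f (\<psi> v) use bounds of v on the support
  of \<psi> alone. Moreover, the transform of f \<psi> is small only in the cone; elsewhere it is
  merely known to grow at most polynomially. A frequency \<eta> outside the cone has distance at
  least \<delta> |\<xi>| from every \<xi> in a narrower cone, so the decay of the transform of
  \<theta> at \<xi> - \<eta> yields arbitrarily many powers of both |\<xi>| and |\<eta>|, enough to
  absorb that growth and to sum over \<eta>. Integer frequencies correspond to period 1, which suits
  (i) because the support of \<phi> lies in a cube of side less than 1. Condition (ii) gives decay
  at all real frequencies of a cone, so there the period may be as large as the support of \<psi>
  demands.\<close>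

lemma iter_deriv_Nil [simp]: "iter_deriv [] u = u"
  and iter_deriv_Cons: "iter_deriv (j # js) u = partial_deriv j (iter_deriv js u)"
  and iter_deriv_append: "iter_deriv (is @ js) u = iter_deriv is (iter_deriv js u)"
  by (simp_all add: iter_deriv_def)

lemma smooth_differentiable: "smooth u \<Longrightarrow> u differentiable (at x)"
  unfolding smooth_def by (metis iter_deriv_Nil)

lemma smooth_continuous_on: "smooth u \<Longrightarrow> continuous_on A u"
  by (intro differentiable_imp_continuous_on differentiable_at_imp_differentiable_on
      smooth_differentiable)

lemma smooth_iter_deriv: "smooth u \<Longrightarrow> smooth (iter_deriv js u)"
  unfolding smooth_def by (simp flip: iter_deriv_append)

lemma smooth_partial_deriv: "smooth u \<Longrightarrow> smooth (partial_deriv j u)"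
  using smooth_iter_deriv[of u "[j]"] by (simp add: iter_deriv_Cons)

lemma partial_deriv_eqI: "(u has_derivative D) (at x) \<Longrightarrow> partial_deriv j u x = D (axis j 1)"
  unfolding partial_deriv_def by (metis frechet_derivative_at)

lemma partial_deriv_const: "partial_deriv j (\<lambda>x. c) = (\<lambda>x. 0)"
  by (rule ext, rule partial_deriv_eqI[where D = "\<lambda>_. 0"]) (rule has_derivative_const)

lemma partial_deriv_add:
  assumes "\<And>x. u differentiable (at x)" "\<And>x. v differentiable (at x)"
  shows "partial_deriv j (\<lambda>x. u x + v x) = (\<lambda>x. partial_deriv j u x + partial_deriv j v x)"
proof
  fix x
  note frechet_derivative_works[THEN iffD1, OF assms(1)[of x]] frechet_derivative_works[THEN iffD1, OF assms(2)[of x]]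
  from has_derivative_add[OF this]
  show "partial_deriv j (\<lambda>x. u x + v x) x = partial_deriv j u x + partial_deriv j v x"
    by (simp add: partial_deriv_eqI) (simp add: partial_deriv_def)
qed

lemma partial_deriv_mult:
  assumes "\<And>x. u differentiable (at x)" "\<And>x. v differentiable (at x)"
  shows "partial_deriv j (\<lambda>x. u x * v x) =
    (\<lambda>x. partial_deriv j u x * v x + u x * partial_deriv j v x)"
proof
  fix x
  note frechet_derivative_works[THEN iffD1, OF assms(1)[of x]] frechet_derivative_works[THEN iffD1, OF assms(2)[of x]]
  from has_derivative_mult[OF this]
  show "partial_deriv j (\<lambda>x. u x * v x) x = partial_deriv j u x * v x + u x * partial_deriv j v x"
    by (simp add: partial_deriv_eqI) (simp add: partial_deriv_def)
qed

inductive_set function_algebra :: "(real^'d::finite \<Rightarrow> complex) set \<Rightarrow> (real^'d \<Rightarrow> complex) set"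
  for S where
  base: "u \<in> S \<Longrightarrow> u \<in> function_algebra S"
| const: "(\<lambda>x. c) \<in> function_algebra S"
| add: "u \<in> function_algebra S \<Longrightarrow> v \<in> function_algebra S \<Longrightarrow> (\<lambda>x. u x + v x) \<in> function_algebra S"
| mult: "u \<in> function_algebra S \<Longrightarrow> v \<in> function_algebra S \<Longrightarrow> (\<lambda>x. u x * v x) \<in> function_algebra S"

text \<open>All smoothness proofs below rest on this coinduction principle: iterated derivatives never
  leave an algebra whose generators have their partial derivatives in the algebra.\<close>

lemma function_algebra_smooth:
  assumes diff: "\<And>u x. u \<in> S \<Longrightarrow> u differentiable (at x)"
    and closed: "\<And>u j. u \<in> S \<Longrightarrow> partial_deriv j u \<in> function_algebra S"
    and "u \<in> function_algebra S"
  shows "smooth u"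
proof -
  have d: "\<forall>x. u differentiable (at x)" if "u \<in> function_algebra S" for u
    using that by induction (auto intro!: diff derivative_intros)
  have p: "partial_deriv j u \<in> function_algebra S" if "u \<in> function_algebra S" for u j
    using that
  proof induction
    case (base u) then show ?case by (rule closed)
  next
    case (const c) then show ?case
      by (simp add: partial_deriv_const function_algebra.const)
  next
    case (add u v) then show ?case
      using d by (subst partial_deriv_add) (auto intro: function_algebra.intros)
  next
    case (mult u v) then show ?case
      using d by (subst partial_deriv_mult) (auto intro!: function_algebra.add function_algebra.mult)
  qed
  have "iter_deriv js u \<in> function_algebra S" for js
    by (induction js) (auto simp: iter_deriv_Cons assms(3) intro: p)
  then show ?thesis
    using d by (auto simp: smooth_def)
qed

text \<open>With all smooth functions as generators, the principle gives closure under sums and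
  products without a Leibniz formula for higher derivatives.\<close>

lemma smooth_algebra: "u \<in> function_algebra (Collect smooth) \<Longrightarrow> smooth u"
  by (erule function_algebra_smooth[rotated 2])
    (auto intro: smooth_differentiable smooth_partial_deriv function_algebra.base)

lemma smooth_const [intro, simp]: "smooth (\<lambda>x. c)"
  and smooth_add [intro]: "smooth u \<Longrightarrow> smooth v \<Longrightarrow> smooth (\<lambda>x. u x + v x)"
  and smooth_mult [intro]: "smooth u \<Longrightarrow> smooth v \<Longrightarrow> smooth (\<lambda>x. u x * v x)"
  by (auto intro!: smooth_algebra intro: function_algebra.intros)

lemma smooth_diff [intro]: "smooth u \<Longrightarrow> smooth v \<Longrightarrow> smooth (\<lambda>x. u x - v x)"
  using smooth_add[of u "\<lambda>x. (-1) * v x"] smooth_mult[of "\<lambda>x. -1" v] by simp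

lemma smooth_sum [intro]: "(\<And>i. i \<in> I \<Longrightarrow> smooth (u i)) \<Longrightarrow> smooth (\<lambda>x. \<Sum>i\<in>I. u i x)"
  by (induction I rule: infinite_finite_induct) auto

lemma smooth_prod [intro]: "(\<And>i. i \<in> I \<Longrightarrow> smooth (u i)) \<Longrightarrow> smooth (\<lambda>x. \<Prod>i\<in>I. u i x)"
  by (induction I rule: infinite_finite_induct) auto

text \<open>The derivative of 1/u is -(1/u) u' (1/u), a polynomial in 1/u and smooth functions; so
  adjoining 1/u to the smooth functions gives generators whose derivatives stay in the
  algebra.\<close>

lemma smooth_inverse [intro]:
  assumes u: "smooth u" and nz: "\<And>x. u x \<noteq> 0"
  shows "smooth (\<lambda>x. inverse (u x))"
proof (rule function_algebra_smooth)
  let ?S = "insert (\<lambda>x. inverse (u x)) (Collect smooth)"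
  have d: "((\<lambda>x. inverse (u x)) has_derivative
      (\<lambda>h. - (inverse (u x) * frechet_derivative u (at x) h * inverse (u x)))) (at x)" for x
    using frechet_derivative_works[THEN iffD1, OF smooth_differentiable[OF u, of x]] nz
    by (auto intro!: derivative_eq_intros)
  then show "v differentiable (at x)" if "v \<in> ?S" for v x
    using that smooth_differentiable by (auto simp: differentiable_def)
  have "partial_deriv j (\<lambda>x. inverse (u x)) =
      (\<lambda>x. (-1) * (inverse (u x) * partial_deriv j u x * inverse (u x)))" for j
    by (rule ext, subst partial_deriv_eqI[OF d]) (simp add: partial_deriv_def)
  also have "\<dots> j \<in> function_algebra ?S" for j
    by (intro function_algebra.mult function_algebra.const)
      (auto intro: function_algebra.base smooth_partial_deriv u)
  finally show "partial_deriv j v \<in> function_algebra ?S" if "v \<in> ?S" for v j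
    using that smooth_partial_deriv by (auto intro: function_algebra.base)
qed (auto intro: function_algebra.base)

lemma iter_deriv_add:
  assumes "smooth u" "smooth v"
  shows "iter_deriv js (\<lambda>x. u x + v x) = (\<lambda>x. iter_deriv js u x + iter_deriv js v x)"
  by (induction js)
    (simp_all add: iter_deriv_Cons partial_deriv_add smooth_differentiable smooth_iter_deriv assms)

lemma iter_deriv_cmult:
  assumes "smooth u"
  shows "iter_deriv js (\<lambda>x. c * u x) = (\<lambda>x. c * iter_deriv js u x)"
  by (induction js)
    (simp_all add: iter_deriv_Cons partial_deriv_mult partial_deriv_const smooth_differentiable
      smooth_iter_deriv assms)

lemma iter_deriv_0: "iter_deriv js (\<lambda>x. 0) = (\<lambda>x. 0)"
  by (induction js) (simp_all add: iter_deriv_Cons partial_deriv_const)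

lemma iter_deriv_sum:
  assumes "\<And>i. i \<in> I \<Longrightarrow> smooth (u i)"
  shows "iter_deriv js (\<lambda>x. \<Sum>i\<in>I. u i x) = (\<lambda>x. \<Sum>i\<in>I. iter_deriv js (u i) x)"
  using assms
  by (induction I rule: infinite_finite_induct) (auto simp: iter_deriv_0 iter_deriv_add smooth_sum)

lemma iter_deriv_diff:
  assumes "smooth u" "smooth v"
  shows "iter_deriv js (\<lambda>x. u x - v x) = (\<lambda>x. iter_deriv js u x - iter_deriv js v x)"
proof -
  have "iter_deriv js (\<lambda>x. u x + (-1) * v x) = (\<lambda>x. iter_deriv js u x + (-1) * iter_deriv js v x)"
    by (simp only: iter_deriv_add[OF assms(1) smooth_mult[OF smooth_const assms(2)]]
        iter_deriv_cmult[OF assms(2)])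
  then show ?thesis by simp
qed

section \<open>Plane waves\<close>

definition wave :: "real^'d::finite \<Rightarrow> real^'d \<Rightarrow> complex" where
  "wave \<xi> x = exp (- 2 * of_real pi * \<i> * of_real (\<xi> \<bullet> x))"

lemma wave_0 [simp]: "wave 0 x = 1"
  by (simp add: wave_def)

lemma wave_add: "wave (\<xi> + \<eta>) x = wave \<xi> x * wave \<eta> x"
  by (simp add: wave_def inner_add_left algebra_simps flip: exp_add)

lemma norm_wave [simp]: "norm (wave \<xi> x) = 1"
proof -
  have "wave \<xi> x = exp (\<i> * of_real (- 2 * pi * (\<xi> \<bullet> x)))"
    by (simp add: wave_def algebra_simps)
  then show ?thesis by (simp only: norm_exp_i_times)
qed

lemma cnj_wave: "cnj (wave \<xi> x) = wave (- \<xi>) x"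
  by (simp add: wave_def exp_cnj)

lemma wave_has_derivative:
  "(wave \<xi> has_derivative (\<lambda>h. - 2 * of_real pi * \<i> * of_real (\<xi> \<bullet> h) * wave \<xi> x)) (at x within A)"
proof -
  have "((\<lambda>x. - 2 * of_real pi * \<i> * of_real (\<xi> \<bullet> x)) has_derivative
      (\<lambda>h. - 2 * of_real pi * \<i> * of_real (\<xi> \<bullet> h))) (at x within A)"
    by (intro derivative_intros)
  from has_derivative_compose[OF this DERIV_exp[unfolded has_field_derivative_def]]
  show ?thesis
    by (simp add: wave_def[abs_def] mult.commute)
qed

lemma partial_deriv_wave:
  "partial_deriv j (wave \<xi>) = (\<lambda>x. (- 2 * of_real pi * \<i> * of_real (\<xi> $ j)) * wave \<xi> x)"
  by (rule ext, subst partial_deriv_eqI[OF wave_has_derivative]) (simp add: inner_axis)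

lemma smooth_wave [intro, simp]: "smooth (wave \<xi>)"
proof (rule function_algebra_smooth[where S = "{wave \<xi>}"])
  have "partial_deriv j (wave \<xi>) \<in> function_algebra {wave \<xi>}" for j
    unfolding partial_deriv_wave
    by (intro function_algebra.mult function_algebra.const function_algebra.base singletonI)
  then show "partial_deriv j u \<in> function_algebra {wave \<xi>}" if "u \<in> {wave \<xi>}" for u j
    using that by simp
qed (use wave_has_derivative in \<open>auto simp: differentiable_def intro: function_algebra.base\<close>)

section \<open>Bump functions\<close>

text \<open>The case k = 0 is the classical exp (-1/t), extended by 0. The powers of 1/t are
  included so that the derivatives of the family are linear combinations of its members.\<close>

definition flat_fun :: "nat \<Rightarrow> real \<Rightarrow> real" where
  "flat_fun k t = (if t > 0 then (1 / t) ^ k * exp (- (1 / t)) else 0)"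

text \<open>Under s = 1/t the right-hand limit becomes that of s^k / exp s at infinity.\<close>

lemma flat_fun_tendsto_0: "(flat_fun k \<longlongrightarrow> 0) (at 0)"
proof -
  have "((\<lambda>s::real. s ^ k / exp s) \<longlongrightarrow> 0) at_top"
    by (rule tendsto_power_div_exp_0)
  moreover have "filterlim (\<lambda>t::real. 1 / t) at_top (at_right 0)"
    using filterlim_inverse_at_top_right by (simp add: inverse_eq_divide)
  ultimately have "((\<lambda>t. (1 / t) ^ k / exp (1 / t)) \<longlongrightarrow> 0) (at_right (0::real))"
    by (rule filterlim_compose)
  then have "(flat_fun k \<longlongrightarrow> 0) (at_right 0)"
    by (rule tendsto_cong[THEN iffD1, rotated])
      (auto simp: flat_fun_def exp_minus field_simps eventually_at_filter)
  moreover have "(flat_fun k \<longlongrightarrow> 0) (at_left 0)"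
    by (rule tendsto_eventually) (auto simp: flat_fun_def eventually_at_filter)
  ultimately show ?thesis
    by (simp add: filterlim_split_at)
qed

lemma flat_fun_has_real_derivative:
  "(flat_fun k has_real_derivative flat_fun (k + 2) t - real k * flat_fun (k + 1) t) (at t)"
proof -
  consider "t > 0" | "t < 0" | "t = 0" by linarith
  then show ?thesis
  proof cases
    case 1
    have "((\<lambda>t. (1 / t) ^ k * exp (- (1 / t))) has_real_derivative
        flat_fun (k + 2) t - real k * flat_fun (k + 1) t) (at t)"
      using 1
      by (auto intro!: derivative_eq_intros simp: flat_fun_def)
        \<comment> \<open>The power rule produces the exponent k - 1, which is truncated at k =
          0.\<close>
        (cases k, simp_all add: field_simps power2_eq_square)
    then show ?thesis
      by (rule has_field_derivative_transform_within_open[of _ _ _ "{0<..}"])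
        (use 1 in \<open>auto simp: flat_fun_def\<close>)
  next
    case 2
    have "((\<lambda>t. 0) has_real_derivative 0) (at t)" by simp
    then have "(flat_fun k has_real_derivative 0) (at t)"
      by (rule has_field_derivative_transform_within_open[of _ _ _ "{..<0}"])
        (use 2 in \<open>auto simp: flat_fun_def\<close>)
    then show ?thesis using 2 by (simp add: flat_fun_def)
  next
    case 3
    \<comment> \<open>Away from 0 the difference quotient at 0 is the next member
      \<open>flat_fun (Suc k)\<close> of the family.\<close>
    have "((\<lambda>h. flat_fun k h / h) \<longlongrightarrow> 0) (at 0)"
      by (rule tendsto_cong[THEN iffD1, OF _ flat_fun_tendsto_0[of "Suc k"]])
        (auto simp: flat_fun_def eventually_at_filter)
    then show ?thesis
      using 3 by (simp add: has_field_derivative_iff flat_fun_def)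
  qed
qed

text \<open>The generators are the compositions for all k at once, since differentiation leads from
  k to k + 1 and k + 2. The slope s provides both orientations, for the two opposite faces of a
  box.\<close>

lemma smooth_flat_fun:
  fixes j :: "'d::finite"
  shows "smooth (\<lambda>x::real^'d. of_real (flat_fun k (s * x $ j + a)) :: complex)"
proof (rule function_algebra_smooth)
  let ?h = "\<lambda>k x::real^'d. of_real (flat_fun k (s * x $ j + a)) :: complex"
  have d: "(?h k has_derivative (\<lambda>y. of_real
      ((flat_fun (k + 2) (s * x $ j + a) - real k * flat_fun (k + 1) (s * x $ j + a)) * (s * y $ j))))
      (at x)" for k x
  proof -
    have "((\<lambda>x. s * x $ j + a) has_derivative (\<lambda>y. s * y $ j)) (at x)"
      by (auto intro!: derivative_eq_intros bounded_linear.has_derivative[OF bounded_linear_vec_nth])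
    then have "((\<lambda>x. flat_fun k (s * x $ j + a)) has_derivative
      (\<lambda>y. (s * y $ j) * (flat_fun (k + 2) (s * x $ j + a) - real k * flat_fun (k + 1) (s * x $ j + a)))) (at x)"
      by (rule DERIV_compose_FDERIV[OF flat_fun_has_real_derivative])
    then show ?thesis
      by (auto intro!: derivative_eq_intros simp: algebra_simps)
  qed
  show "u differentiable (at x)" if "u \<in> range ?h" for u x
    using that d by (auto simp: differentiable_def)
  have "partial_deriv i (?h k) = (\<lambda>x. of_real (s * axis j 1 $ i) * (?h (k + 2) x + of_real (- real k) * ?h (k + 1) x))" for i k
    by (rule ext, subst partial_deriv_eqI[OF d]) (simp add: algebra_simps axis_def)
  then have "partial_deriv i (?h k) \<in> function_algebra (range ?h)" for i k
    by (simp only:) (intro function_algebra.mult function_algebra.add function_algebra.const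
        function_algebra.base rangeI)
  then show "partial_deriv i u \<in> function_algebra (range ?h)" if "u \<in> range ?h" for u i
    using that by auto
qed (auto intro: function_algebra.base)

lemma flat_fun_nonneg: "0 \<le> flat_fun k t"
  and flat_fun_pos_iff: "0 < flat_fun k t \<longleftrightarrow> 0 < t"
  and flat_fun_eq_0_iff: "flat_fun k t = 0 \<longleftrightarrow> t \<le> 0"
  by (auto simp: flat_fun_def)

text \<open>The bump is \<open>p / (p + q)\<close>. The product \<open>p\<close> is positive exactly
  on the open box of half-width 2 \<delta>, the sum \<open>q\<close> exactly outside the closed box
  of half-width \<delta>. So the denominator never vanishes, and the quotient is 1 where
  \<open>q\<close> = 0 and 0 where \<open>p\<close> = 0.\<close>

lemma smooth_box_bump:
  fixes a :: "real^'d::finite"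
  assumes "\<delta> > 0"
  obtains \<beta> where "smooth \<beta>" "\<And>x. (\<And>j. \<bar>x $ j - a $ j\<bar> \<le> \<delta>) \<Longrightarrow> \<beta> x = 1"
    "\<And>x j. \<beta> x \<noteq> 0 \<Longrightarrow> \<bar>x $ j - a $ j\<bar> < 2 * \<delta>"
proof
  define p where "p x = (\<Prod>j\<in>UNIV. flat_fun 0 (-1 * x $ j + (a $ j + 2 * \<delta>)) * flat_fun 0 (1 * x $ j + (2 * \<delta> - a $ j)))"
    for x :: "real^'d"
  define q where "q x = (\<Sum>j\<in>UNIV. flat_fun 0 (1 * x $ j + (- a $ j - \<delta>)) + flat_fun 0 (-1 * x $ j + (a $ j - \<delta>)))"
    for x :: "real^'d"
  define \<beta> :: "real^'d \<Rightarrow> complex" where "\<beta> x = of_real (p x) * inverse (of_real (p x) + of_real (q x))" for x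
  have p0: "p x \<ge> 0" and q0: "q x \<ge> 0" for x
    by (auto simp: p_def q_def intro!: prod_nonneg sum_nonneg mult_nonneg_nonneg add_nonneg_nonneg flat_fun_nonneg)
  have ppos: "p x > 0" if "\<And>j. \<bar>x $ j - a $ j\<bar> \<le> \<delta>" for x
  proof -
    have "flat_fun 0 (-1 * x $ j + (a $ j + 2 * \<delta>)) * flat_fun 0 (1 * x $ j + (2 * \<delta> - a $ j)) > 0" for j
      using that[of j] assms by (intro mult_pos_pos) (auto simp: flat_fun_pos_iff)
    then show ?thesis unfolding p_def by (intro prod_pos) auto
  qed
  have qpos: "q x > 0" if "\<bar>x $ j - a $ j\<bar> > \<delta>" for x j
    unfolding q_def
  proof (rule sum_pos2[of _ j])
    from that consider "x $ j + (- a $ j - \<delta>) > 0" | "- x $ j + (a $ j - \<delta>) > 0"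
      by (cases "x $ j < a $ j") linarith+
    then show "0 < flat_fun 0 (1 * x $ j + (- a $ j - \<delta>)) + flat_fun 0 (-1 * x $ j + (a $ j - \<delta>))"
      by cases (auto intro: add_nonneg_pos add_pos_nonneg simp: flat_fun_pos_iff flat_fun_nonneg)
  qed (auto intro: add_nonneg_nonneg flat_fun_nonneg)
  have pos: "p x + q x > 0" for x
    using ppos[of x] qpos[of x] p0[of x] q0[of x] by (meson add_nonneg_pos add_pos_nonneg not_le)
  then have nz: "complex_of_real (p x) + of_real (q x) \<noteq> 0" for x
    by (metis less_irrefl of_real_0 of_real_add of_real_eq_iff)
  have "smooth (\<lambda>x. complex_of_real (p x))" "smooth (\<lambda>x. complex_of_real (q x))"
    unfolding p_def q_def of_real_prod of_real_sum of_real_mult of_real_add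
    by (intro smooth_prod smooth_sum smooth_mult smooth_add smooth_flat_fun)+
  then show "smooth \<beta>"
    unfolding \<beta>_def[abs_def] by (intro smooth_mult smooth_inverse smooth_add nz)
  show "\<beta> x = 1" if "\<And>j. \<bar>x $ j - a $ j\<bar> \<le> \<delta>" for x
  proof -
    have "q x = 0"
      unfolding q_def
    proof (intro sum.neutral ballI)
      fix j
      show "flat_fun 0 (1 * x $ j + (- a $ j - \<delta>)) + flat_fun 0 (-1 * x $ j + (a $ j - \<delta>)) = 0"
        using that[of j] by (simp add: flat_fun_eq_0_iff[THEN iffD2])
    qed
    then show ?thesis using ppos[OF that] by (simp add: \<beta>_def)
  qed
  show "\<bar>x $ j - a $ j\<bar> < 2 * \<delta>" if "\<beta> x \<noteq> 0" for x j
  proof -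
    have "p x \<noteq> 0" using that by (auto simp: \<beta>_def)
    then have "flat_fun 0 (-1 * x $ j + (a $ j + 2 * \<delta>)) \<noteq> 0" "flat_fun 0 (1 * x $ j + (2 * \<delta> - a $ j)) \<noteq> 0"
      by (auto simp: p_def)
    then show ?thesis by (simp add: flat_fun_eq_0_iff)
  qed
qed

section \<open>Supports and test functions\<close>

lemma fun_support_closed [simp]: "closed (fun_support u)"
  by (simp add: fun_support_def)

lemma fun_support_superset: "u x \<noteq> 0 \<Longrightarrow> x \<in> fun_support u"
  unfolding fun_support_def by (meson closure_subset mem_Collect_eq subsetD)

lemma not_in_fun_support: "x \<notin> fun_support u \<Longrightarrow> u x = 0"
  using fun_support_superset by blast

lemma fun_support_subset: "(\<And>x. u x \<noteq> 0 \<Longrightarrow> x \<in> T) \<Longrightarrow> closed T \<Longrightarrow> fun_support u \<subseteq> T"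
  unfolding fun_support_def by (rule closure_minimal) auto

lemma fun_support_mono: "(\<And>x. u x \<noteq> 0 \<Longrightarrow> v x \<noteq> 0) \<Longrightarrow> fun_support u \<subseteq> fun_support v"
  unfolding fun_support_def by (rule closure_mono) auto

lemma test_functionsI:
  assumes "smooth u" "compact K" "K \<subseteq> \<Omega>" "\<And>x. u x \<noteq> 0 \<Longrightarrow> x \<in> K"
  shows "u \<in> test_functions \<Omega>"
proof -
  have "fun_support u \<subseteq> K"
    using assms by (intro fun_support_subset) (auto intro: compact_imp_closed)
  then show ?thesis
    using assms compact_Int_closed[of K "fun_support u"]
    by (auto simp: test_functions_def Int_absorb1)
qed

lemma test_functions_smooth: "u \<in> test_functions \<Omega> \<Longrightarrow> smooth u"
  and test_functions_compact: "u \<in> test_functions \<Omega> \<Longrightarrow> compact (fun_support u)"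
  and test_functions_support: "u \<in> test_functions \<Omega> \<Longrightarrow> fun_support u \<subseteq> \<Omega>"
  and test_functions_mono: "u \<in> test_functions \<Omega> \<Longrightarrow> \<Omega> \<subseteq> \<Omega>' \<Longrightarrow> u \<in> test_functions \<Omega>'"
  by (auto simp: test_functions_def)

lemma test_functions_UNIV: "u \<in> test_functions \<Omega> \<Longrightarrow> u \<in> test_functions UNIV"
  by (rule test_functions_mono) auto

lemma test_functions_mult_left:
  assumes "u \<in> test_functions \<Omega>" "smooth v"
  shows "(\<lambda>x. u x * v x) \<in> test_functions \<Omega>"
  by (rule test_functionsI[of _ "fun_support u"])
    (use assms in \<open>auto simp: test_functions_def intro: fun_support_superset\<close>)

lemma test_functions_mult_right:
  assumes "u \<in> test_functions \<Omega>" "smooth v"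
  shows "(\<lambda>x. v x * u x) \<in> test_functions \<Omega>"
  using test_functions_mult_left[OF assms] by (simp add: mult.commute)

lemma test_function_bump_at:
  fixes a :: "real^'d::finite"
  assumes "open U" "a \<in> U"
  obtains \<beta> V where "\<beta> \<in> test_functions U" "open V" "a \<in> V" "\<And>x. x \<in> V \<Longrightarrow> \<beta> x = 1"
proof -
  obtain r where r: "r > 0" "cball a r \<subseteq> U"
    using assms open_contains_cball by blast
  \<comment> \<open>The bump lives in a box of half-width 2 \<delta>. By the l1 bound on the norm,
    CARD('d) coordinates of size at most 2 \<delta> give a norm of at most r.\<close>
  define \<delta> where "\<delta> = r / (2 * CARD('d))"
  have \<delta>: "\<delta> > 0" using r by (simp add: \<delta>_def)
  obtain \<beta> where \<beta>: "smooth \<beta>" "\<And>x. (\<And>j. \<bar>x $ j - a $ j\<bar> \<le> \<delta>) \<Longrightarrow> \<beta> x = 1"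
    "\<And>x j. \<beta> x \<noteq> 0 \<Longrightarrow> \<bar>x $ j - a $ j\<bar> < 2 * \<delta>"
    using smooth_box_bump[OF \<delta>, of a] by blast
  have "x \<in> cball a r" if "\<beta> x \<noteq> 0" for x
  proof -
    have "norm (x - a) \<le> (\<Sum>j\<in>UNIV. \<bar>(x - a) $ j\<bar>)"
      by (rule norm_le_l1_cart)
    also have "\<dots> \<le> (\<Sum>j\<in>(UNIV::'d set). 2 * \<delta>)"
      using \<beta>(3)[OF that] by (intro sum_mono) (auto intro: less_imp_le)
    also have "\<dots> = r" by (simp add: \<delta>_def)
    finally show ?thesis by (simp add: dist_norm norm_minus_commute)
  qed
  then have "\<beta> \<in> test_functions U"
    using \<beta>(1) r by (intro test_functionsI[of _ "cball a r"]) auto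
  moreover have "\<beta> x = 1" if "x \<in> ball a \<delta>" for x
  proof (rule \<beta>(2))
    show "\<bar>x $ j - a $ j\<bar> \<le> \<delta>" for j
      using component_le_norm_cart[of "x - a" j] that by (simp add: dist_norm norm_minus_commute)
  qed
  ultimately show thesis
    using that[of \<beta> "ball a \<delta>"] \<delta> by simp
qed

text \<open>For a finite subcover, 1 - \<Prod>(1 - \<beta>) is 1 as soon as one of the local bumps
  \<beta> is 1, and 0 where all of them vanish; no partition of unity is involved.\<close>

lemma test_function_bump:
  fixes K :: "(real^'d::finite) set"
  assumes "compact K" "open U" "K \<subseteq> U"
  obtains \<theta> V where "\<theta> \<in> test_functions U" "open V" "K \<subseteq> V" "\<And>x. x \<in> V \<Longrightarrow> \<theta> x = 1"
proof -
  define good where "good a \<beta> V \<longleftrightarrow> \<beta> \<in> test_functions U \<and> open V \<and> a \<in> V \<and> (\<forall>x\<in>V. \<beta> x = 1)"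
    for a \<beta> V
  have "\<exists>\<beta> V. good a \<beta> V" if "a \<in> K" for a
    unfolding good_def
    by (rule test_function_bump_at[OF \<open>open U\<close>, of a]) (use that assms(3) in blast)+
  then obtain \<beta> V where "\<And>a. a \<in> K \<Longrightarrow> good a (\<beta> a) (V a)"
    by metis
  then have b: "\<And>a. a \<in> K \<Longrightarrow> \<beta> a \<in> test_functions U" "\<And>a. a \<in> K \<Longrightarrow> open (V a)"
      "\<And>a. a \<in> K \<Longrightarrow> a \<in> V a" "\<And>a x. a \<in> K \<Longrightarrow> x \<in> V a \<Longrightarrow> \<beta> a x = 1"
    unfolding good_def by simp_all
  have "K \<subseteq> (\<Union>a\<in>K. V a)" using b(3) by blast
  then obtain I where I: "I \<subseteq> K" "finite I" "K \<subseteq> (\<Union>a\<in>I. V a)"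
    using compactE_image[OF \<open>compact K\<close>, of K V] b(2) by metis
  let ?\<theta> = "\<lambda>x. 1 - (\<Prod>a\<in>I. 1 - \<beta> a x)"
  have "?\<theta> \<in> test_functions U"
  proof (rule test_functionsI)
    show "smooth ?\<theta>"
      using I b(1) by (intro smooth_diff smooth_const smooth_prod) (auto dest: test_functions_smooth)
    show "compact (\<Union>a\<in>I. fun_support (\<beta> a))"
      using I b(1) by (intro compact_UN) (auto dest: test_functions_compact)
    show "(\<Union>a\<in>I. fun_support (\<beta> a)) \<subseteq> U"
      using I b(1) by (auto dest!: test_functions_support)
    show "x \<in> (\<Union>a\<in>I. fun_support (\<beta> a))" if "?\<theta> x \<noteq> 0" for x
    proof (rule ccontr)
      assume "x \<notin> (\<Union>a\<in>I. fun_support (\<beta> a))"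
      then have "(\<Prod>a\<in>I. 1 - \<beta> a x) = 1"
        by (intro prod.neutral) (auto simp: not_in_fun_support)
      with that show False by simp
    qed
  qed
  moreover have "?\<theta> x = 1" if "x \<in> (\<Union>a\<in>I. V a)" for x
  proof -
    have "(\<Prod>a\<in>I. 1 - \<beta> a x) = 0"
      using that I b(4) by (intro prod_zero) fastforce+
    then show ?thesis by simp
  qed
  ultimately show thesis
    using that[of ?\<theta> "\<Union>a\<in>I. V a"] I b(2) by blast
qed

section \<open>Fourier transforms of localized distributions\<close>

lemma distribution_add:
  "distribution f \<Longrightarrow> \<phi> \<in> test_functions UNIV \<Longrightarrow> \<psi> \<in> test_functions UNIV \<Longrightarrow>
    f (\<lambda>x. \<phi> x + \<psi> x) = f \<phi> + f \<psi>"
  and distribution_cmult: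
  "distribution f \<Longrightarrow> \<phi> \<in> test_functions UNIV \<Longrightarrow> f (\<lambda>x. c * \<phi> x) = c * f \<phi>"
  by (auto simp: distribution_def)

lemma test_functions_0 [simp]: "(\<lambda>x. 0) \<in> test_functions \<Omega>"
  by (rule test_functionsI[of _ "{}"]) auto

lemma distribution_0: "distribution f \<Longrightarrow> f (\<lambda>x. 0) = 0"
  using distribution_cmult[of f "\<lambda>x. 0" 0] by simp

lemma distribution_split:
  assumes "distribution f" "\<phi> \<in> test_functions UNIV" "smooth \<kappa>"
  shows "f \<phi> = f (\<lambda>x. \<phi> x * \<kappa> x) + f (\<lambda>x. \<phi> x * (1 - \<kappa> x))"
proof -
  have "f (\<lambda>x. \<phi> x * \<kappa> x) + f (\<lambda>x. \<phi> x * (1 - \<kappa> x)) = f (\<lambda>x. \<phi> x * \<kappa> x + \<phi> x * (1 - \<kappa> x))"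
    by (rule distribution_add[symmetric])
      (intro assms test_functions_mult_left smooth_diff smooth_const)+
  then show ?thesis by (simp add: algebra_simps)
qed

text \<open>Vanishing near each point has to be turned into vanishing on \<phi>. Finitely many local
  bumps \<beta> cover the support of \<phi>. Multiplying by one more factor 1 - \<beta> does not
  change the value, because the discarded part, a multiple of \<beta>, is a test function on an open
  set where the functional vanishes. Once all factors are present, the argument is identically
  0.\<close>

lemma distr_support_vanish:
  assumes f: "distribution f" "\<psi> \<in> test_functions UNIV" and \<phi>: "\<phi> \<in> test_functions UNIV"
    and disj: "fun_support \<phi> \<inter> distr_support (mult_distr f \<psi>) = {}"
  shows "f (\<lambda>x. \<psi> x * \<phi> x) = 0"
proof -
  let ?g = "mult_distr f \<psi>"
  define good where "good a \<beta> V \<longleftrightarrow> smooth \<beta> \<and> open V \<and> a \<in> V \<and> (\<forall>x\<in>V. \<beta> x = 1) \<and>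
      (\<forall>v. smooth v \<longrightarrow> ?g (\<lambda>x. v x * \<beta> x) = 0)" for a :: "real^'a" and \<beta> V
  have "\<exists>\<beta> V. good a \<beta> V" if a: "a \<in> fun_support \<phi>" for a
  proof -
    obtain U where U: "open U" "a \<in> U" "\<forall>\<phi>\<in>test_functions U. ?g \<phi> = 0"
      using a disj unfolding distr_support_def by auto
    obtain \<beta> V where "\<beta> \<in> test_functions U" "open V" "a \<in> V" "\<And>x. x \<in> V \<Longrightarrow> \<beta> x = 1"
      using test_function_bump_at[OF U(1,2)] by blast
    with U(3) have "good a \<beta> V"
      by (auto simp: good_def test_functions_mult_right dest: test_functions_smooth)
    then show ?thesis by blast
  qed
  then obtain \<beta> V where "\<And>a. a \<in> fun_support \<phi> \<Longrightarrow> good a (\<beta> a) (V a)"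
    by metis
  then have b: "\<And>a. a \<in> fun_support \<phi> \<Longrightarrow> smooth (\<beta> a)"
      "\<And>a. a \<in> fun_support \<phi> \<Longrightarrow> open (V a)"
      "\<And>a. a \<in> fun_support \<phi> \<Longrightarrow> a \<in> V a"
      "\<And>a x. a \<in> fun_support \<phi> \<Longrightarrow> x \<in> V a \<Longrightarrow> \<beta> a x = 1"
      "\<And>a v. a \<in> fun_support \<phi> \<Longrightarrow> smooth v \<Longrightarrow> ?g (\<lambda>x. v x * \<beta> a x) = 0"
    unfolding good_def by simp_all
  have "fun_support \<phi> \<subseteq> (\<Union>a\<in>fun_support \<phi>. V a)" using b(3) by blast
  then obtain I where I: "I \<subseteq> fun_support \<phi>" "finite I" "fun_support \<phi> \<subseteq> (\<Union>a\<in>I. V a)"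
    using compactE_image[OF test_functions_compact[OF \<phi>], of "fun_support \<phi>" V] b(2) by metis
  have smooth: "smooth (\<lambda>x. \<Prod>a\<in>J. 1 - \<beta> a x)" if "J \<subseteq> I" for J
    using that I b(1) by (intro smooth_prod smooth_diff smooth_const) auto
  have "f (\<lambda>x. \<psi> x * \<phi> x) = f (\<lambda>x. \<psi> x * \<phi> x * (\<Prod>a\<in>I. 1 - \<beta> a x))"
    using I(2) order_refl
  proof (induction rule: finite_subset_induct')
    case empty
    then show ?case by simp
  next
    case (insert a J)
    have a: "a \<in> fun_support \<phi>" using insert I by auto
    have \<beta>: "smooth (\<beta> a)" by (rule b(1)[OF a])
    let ?P = "\<lambda>x. \<Prod>a\<in>J. 1 - \<beta> a x"
    have P: "smooth ?P" using insert smooth by blast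
    have "f (\<lambda>x. \<psi> x * \<phi> x * ?P x) = f (\<lambda>x. (\<psi> x * \<phi> x * ?P x) * \<beta> a x) + f (\<lambda>x. (\<psi> x * \<phi> x * ?P x) * (1 - \<beta> a x))"
      by (rule distribution_split)
        (intro f \<beta> test_functions_mult_left P test_functions_smooth[OF \<phi>])+
    also have "f (\<lambda>x. (\<psi> x * \<phi> x * ?P x) * \<beta> a x) = ?g (\<lambda>x. \<phi> x * ?P x * \<beta> a x)"
      by (simp add: mult_distr_def mult_ac)
    also have "\<dots> = 0"
      by (rule b(5)[OF a]) (intro smooth_mult P test_functions_smooth[OF \<phi>])
    finally show ?case
      using insert by (simp add: mult_ac)
  qed
  also have "(\<lambda>x. \<psi> x * \<phi> x * (\<Prod>a\<in>I. 1 - \<beta> a x)) = (\<lambda>x. 0)"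
  proof
    fix x
    show "\<psi> x * \<phi> x * (\<Prod>a\<in>I. 1 - \<beta> a x) = 0"
    proof (cases "x \<in> fun_support \<phi>")
      case True
      then obtain a where "a \<in> I" "\<beta> a x = 1"
        using I b(4) by blast
      then have "(\<Prod>a\<in>I. 1 - \<beta> a x) = 0"
        using I(2) by (intro prod_zero) auto
      then show ?thesis by simp
    qed (simp add: not_in_fun_support)
  qed
  finally show ?thesis
    by (simp add: distribution_0 f)
qed

text \<open>The cutoff \<kappa> chosen by \<open>pairing\<close> equals 1 only near
  \<open>distr_support\<close>, which may be smaller than the support of \<psi>. The error \<psi> u
  (1 - \<kappa>) is harmless because (1 - \<kappa>) u vanishes near the support of the
  functional.\<close>

lemma pairing_mult_distr:
  assumes f: "distribution f" and \<psi>: "\<psi> \<in> test_functions UNIV" and u: "smooth u"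
  shows "pairing (mult_distr f \<psi>) u = f (\<lambda>x. \<psi> x * u x)"
proof -
  let ?g = "mult_distr f \<psi>"
  define S where "S = distr_support ?g"
  have "closed S"
    unfolding S_def distr_support_def by (intro closed_Compl open_Union) auto
  moreover have "S \<subseteq> fun_support \<psi>"
  proof
    fix a assume a: "a \<in> S"
    show "a \<in> fun_support \<psi>"
    proof (rule ccontr)
      assume "a \<notin> fun_support \<psi>"
      moreover have "?g \<phi> = 0" if "\<phi> \<in> test_functions (- fun_support \<psi>)" for \<phi>
      proof -
        have "(\<lambda>x. \<psi> x * \<phi> x) = (\<lambda>x. 0)"
          using test_functions_support[OF that] fun_support_superset[of \<psi>] fun_support_superset[of \<phi>]
          by fastforce
        then show ?thesis by (simp add: mult_distr_def distribution_0 f)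
      qed
      ultimately have "a \<in> \<Union>{U. open U \<and> (\<forall>\<phi>\<in>test_functions U. ?g \<phi> = 0)}"
        by (auto intro!: exI[of _ "- fun_support \<psi>"])
      then show False using a by (simp add: S_def distr_support_def)
    qed
  qed
  ultimately have "compact S"
    using compact_Int_closed[OF test_functions_compact[OF \<psi>]] by (metis Int_absorb1)
  \<comment> \<open>Compactness of the support provides a cutoff, so the \<open>SOME\<close> in
    \<open>pairing\<close> really picks one.\<close>
  then have "\<exists>\<kappa>. cutoff_for S \<kappa>"
    using test_function_bump[of S UNIV] unfolding cutoff_for_def by (metis open_UNIV subset_UNIV)
  then have "cutoff_for S (SOME \<kappa>. cutoff_for S \<kappa>)" by (rule someI_ex)
  moreover define \<kappa> where "\<kappa> = (SOME \<kappa>. cutoff_for S \<kappa>)"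
  ultimately obtain U where \<kappa>: "\<kappa> \<in> test_functions UNIV" and U: "open U" "S \<subseteq> U" "\<And>x. x \<in> U \<Longrightarrow> \<kappa> x = 1"
    unfolding cutoff_for_def by blast
  obtain \<theta> V where \<theta>: "\<theta> \<in> test_functions UNIV" "open V" "fun_support \<psi> \<subseteq> V" "\<And>x. x \<in> V \<Longrightarrow> \<theta> x = 1"
    by (rule test_function_bump[OF test_functions_compact[OF \<psi>] open_UNIV subset_UNIV]) blast
  have s: "smooth (\<lambda>x. (1 - \<kappa> x) * u x)"
    by (intro smooth_mult smooth_diff smooth_const u test_functions_smooth[OF \<kappa>])
  have "f (\<lambda>x. \<psi> x * u x) = f (\<lambda>x. \<psi> x * u x * \<kappa> x) + f (\<lambda>x. \<psi> x * u x * (1 - \<kappa> x))"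
    by (intro distribution_split f test_functions_mult_left \<psi> u test_functions_smooth[OF \<kappa>])
  \<comment> \<open>The function (1 - \<kappa>) u need not have compact support. The factor
    \<theta>, equal to 1 near the support of \<psi>, turns it into a test function without changing
    the product.\<close>
  also have "(\<lambda>x. \<psi> x * u x * (1 - \<kappa> x)) = (\<lambda>x. \<psi> x * (\<theta> x * ((1 - \<kappa> x) * u x)))"
  proof
    show "\<psi> x * u x * (1 - \<kappa> x) = \<psi> x * (\<theta> x * ((1 - \<kappa> x) * u x))" for x
      using \<theta>(3,4) by (cases "x \<in> fun_support \<psi>") (auto simp: not_in_fun_support)
  qed
  also have "f \<dots> = 0"
  proof (rule distr_support_vanish[OF f \<psi> test_functions_mult_left[OF \<theta>(1) s]])
    have "fun_support (\<lambda>x. \<theta> x * ((1 - \<kappa> x) * u x)) \<subseteq> - U"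
      using U by (intro fun_support_subset) auto
    then show "fun_support (\<lambda>x. \<theta> x * ((1 - \<kappa> x) * u x)) \<inter> distr_support (mult_distr f \<psi>) = {}"
      using U(2) by (auto simp: S_def)
  qed
  finally show ?thesis
    by (simp add: pairing_def mult_distr_def \<kappa>_def S_def mult_ac)
qed

text \<open>This removes the cutoff from \<open>fourier\<close>; all later estimates concern the
  right-hand side.\<close>

lemma fourier_mult_distr:
  assumes "distribution f" "\<psi> \<in> test_functions UNIV"
  shows "fourier (mult_distr f \<psi>) \<xi> = f (\<lambda>x. \<psi> x * wave \<xi> x)"
  using pairing_mult_distr[OF assms smooth_wave[of \<xi>]] by (simp add: fourier_def wave_def[abs_def])

section \<open>Continuity estimates for products\<close>

lemma partial_deriv_support: "fun_support (partial_deriv j u) \<subseteq> fun_support u"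
proof (rule fun_support_subset)
  fix x assume nz: "partial_deriv j u x \<noteq> 0"
  show "x \<in> fun_support u"
  proof (rule ccontr)
    assume x: "x \<notin> fun_support u"
    have "((\<lambda>_. 0) has_derivative (\<lambda>_. 0)) (at x)" by simp
    then have "(u has_derivative (\<lambda>_. 0)) (at x)"
      by (rule has_derivative_transform_within_open[of _ _ _ _ "- fun_support u"])
        (use x in \<open>auto simp: not_in_fun_support\<close>)
    then show False using nz partial_deriv_eqI by blast
  qed
qed simp

lemma test_functions_partial_deriv:
  assumes "u \<in> test_functions \<Omega>"
  shows "partial_deriv j u \<in> test_functions \<Omega>"
  using assms partial_deriv_support[of j u]
  by (intro test_functionsI[of _ "fun_support u"])
    (auto simp: test_functions_def smooth_partial_deriv intro: fun_support_superset)

lemma test_functions_iter_deriv: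
  "u \<in> test_functions \<Omega> \<Longrightarrow> iter_deriv js u \<in> test_functions \<Omega>"
  by (induction js) (auto simp: iter_deriv_Cons test_functions_partial_deriv)

lemma test_functions_bounded:
  assumes "u \<in> test_functions \<Omega>"
  obtains C where "C \<ge> 0" "\<And>x. norm (u x) \<le> C"
proof -
  have "compact (u ` fun_support u)"
    using assms
    by (intro compact_continuous_image smooth_continuous_on)
      (auto dest: test_functions_smooth test_functions_compact)
  then obtain C where "\<And>x. x \<in> fun_support u \<Longrightarrow> norm (u x) \<le> C"
    using compact_imp_bounded bounded_iff by (metis imageI)
  then have "norm (u x) \<le> max C 0" for x
    using not_in_fun_support[of x u] by (cases "x \<in> fun_support u") (auto simp: max.coboundedI1)
  then show thesis
    using that[of "max C 0"] by simp
qed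

text \<open>The list is peeled from its last entry, the innermost derivative. One product rule then
  leaves products with first factor \<partial>\<psi> or \<psi>, and the induction hypothesis covers
  both because \<psi> is arbitrary in it. The constant does not depend on v, and v is bounded only
  on the support of \<psi>, where a Fourier series can be controlled.\<close>

lemma iter_deriv_mult_bound:
  assumes "\<psi> \<in> test_functions UNIV"
  shows "\<exists>C\<ge>0. \<forall>v B x. smooth v \<longrightarrow> 0 \<le> B \<longrightarrow>
    (\<forall>is. length is \<le> length js \<longrightarrow> (\<forall>y\<in>fun_support \<psi>. norm (iter_deriv is v y) \<le> B)) \<longrightarrow>
    norm (iter_deriv js (\<lambda>x. \<psi> x * v x) x) \<le> C * B"
  using assms
proof (induction js arbitrary: \<psi> rule: rev_induct)
  case Nil
  obtain C where C: "C \<ge> 0" "\<And>x. norm (\<psi> x) \<le> C"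
    using test_functions_bounded[OF Nil] by blast
  have "norm (\<psi> x * v x) \<le> C * B"
    if "\<forall>y\<in>fun_support \<psi>. norm (v y) \<le> B" "0 \<le> B" for v B x
    using that C by (cases "x \<in> fun_support \<psi>")
      (auto simp: norm_mult not_in_fun_support intro!: mult_mono)
  then show ?case
    using C(1) by (intro exI[of _ C]) auto
next
  case (snoc j js)
  obtain C1 where C1: "C1 \<ge> 0" "\<And>v B x. smooth v \<Longrightarrow> 0 \<le> B \<Longrightarrow>
      (\<And>is y. length is \<le> length js \<Longrightarrow> y\<in>fun_support (partial_deriv j \<psi>) \<Longrightarrow> norm (iter_deriv is v y) \<le> B) \<Longrightarrow>
      norm (iter_deriv js (\<lambda>x. partial_deriv j \<psi> x * v x) x) \<le> C1 * B"
    using snoc.IH[OF test_functions_partial_deriv[OF snoc.prems]] by metis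
  obtain C2 where C2: "C2 \<ge> 0" "\<And>v B x. smooth v \<Longrightarrow> 0 \<le> B \<Longrightarrow>
      (\<And>is y. length is \<le> length js \<Longrightarrow> y\<in>fun_support \<psi> \<Longrightarrow> norm (iter_deriv is v y) \<le> B) \<Longrightarrow>
      norm (iter_deriv js (\<lambda>x. \<psi> x * v x) x) \<le> C2 * B"
    using snoc.IH[OF snoc.prems] by metis
  have \<psi>: "smooth \<psi>" using snoc.prems by (rule test_functions_smooth)
  have "norm (iter_deriv (js @ [j]) (\<lambda>x. \<psi> x * v x) x) \<le> (C1 + C2) * B"
    if v: "smooth v" and B: "0 \<le> B"
      and le: "\<And>is y. length is \<le> length (js @ [j]) \<Longrightarrow> y\<in>fun_support \<psi> \<Longrightarrow> norm (iter_deriv is v y) \<le> B" for v B x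
  proof -
    have "iter_deriv (js @ [j]) (\<lambda>x. \<psi> x * v x) x =
        iter_deriv js (\<lambda>x. partial_deriv j \<psi> x * v x) x + iter_deriv js (\<lambda>x. \<psi> x * partial_deriv j v x) x"
      using \<psi> v
      by (simp add: iter_deriv_append iter_deriv_Cons partial_deriv_mult smooth_differentiable
          iter_deriv_add smooth_mult smooth_partial_deriv)
    moreover have "norm (iter_deriv js (\<lambda>x. partial_deriv j \<psi> x * v x) x) \<le> C1 * B"
      using v B partial_deriv_support[of j \<psi>] by (intro C1(2)) (auto intro!: le)
    moreover have "norm (iter_deriv js (\<lambda>x. \<psi> x * partial_deriv j v x) x) \<le> C2 * B"
    proof (intro C2(2) smooth_partial_deriv v B)
      show "norm (iter_deriv is (partial_deriv j v) y) \<le> B"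
        if "length is \<le> length js" "y \<in> fun_support \<psi>" for "is" y
        using le[of "is @ [j]" y] that by (simp add: iter_deriv_append iter_deriv_Cons)
    qed
    ultimately show ?thesis
      by (metis (no_types, lifting) add_mono distrib_right norm_triangle_le)
  qed
  then show ?case
    using C1(1) C2(1) by (intro exI[of _ "C1 + C2"]) auto
qed

lemma distribution_mult_bound:
  fixes f :: "'d::finite functional"
  assumes f: "distribution f" and \<psi>: "\<psi> \<in> test_functions UNIV"
  obtains C k where "C \<ge> 0"
    "\<And>v B. smooth v \<Longrightarrow> 0 \<le> B \<Longrightarrow>
      (\<And>is y. length is \<le> k \<Longrightarrow> y \<in> fun_support \<psi> \<Longrightarrow> norm (iter_deriv is v y) \<le> B) \<Longrightarrow>
      norm (f (\<lambda>x. \<psi> x * v x)) \<le> C * B"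
proof -
  obtain C k where Ck: "\<And>\<phi>. \<phi>\<in>test_functions UNIV \<Longrightarrow> fun_support \<phi> \<subseteq> fun_support \<psi> \<Longrightarrow>
        norm (f \<phi>) \<le> C * (\<Sum>js | length js \<le> k. SUP x. norm (iter_deriv js \<phi> x))"
    using f test_functions_compact[OF \<psi>] unfolding distribution_def by meson
  obtain D where D: "\<And>js. D js \<ge> 0" "\<And>js v B x. smooth v \<Longrightarrow> 0 \<le> B \<Longrightarrow>
      (\<And>is y. length is \<le> length js \<Longrightarrow> y\<in>fun_support \<psi> \<Longrightarrow> norm (iter_deriv is v y) \<le> B) \<Longrightarrow>
      norm (iter_deriv js (\<lambda>x. \<psi> x * v x) x) \<le> D js * B"
    using iter_deriv_mult_bound[OF \<psi>] by metis
  let ?J = "{js::'d list. length js \<le> k}"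
  have fin: "finite ?J"
    using finite_lists_length_le[of "UNIV::'d set" k] by simp
  show thesis
  proof (rule that)
    show "\<bar>C\<bar> * sum D ?J \<ge> 0" by (simp add: D sum_nonneg)
    fix v :: "real^'d \<Rightarrow> complex" and B :: real
    assume v: "smooth v" "0 \<le> B"
      and le: "\<And>is y. length is \<le> k \<Longrightarrow> y \<in> fun_support \<psi> \<Longrightarrow> norm (iter_deriv is v y) \<le> B"
    let ?\<phi> = "\<lambda>x. \<psi> x * v x"
    have bd: "norm (iter_deriv js ?\<phi> x) \<le> D js * B" if "js \<in> ?J" for js x
      using that by (intro D v le) auto
    \<comment> \<open>A real supremum is informative only for a bounded set, which \<open>bd\<close>
      ensures. The lower bound 0 permits the replacement of C, whose sign is unknown, by its
      absolute value.\<close>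
    have SUP: "(SUP x. norm (iter_deriv js ?\<phi> x)) \<in> {0..D js * B}" if "js \<in> ?J" for js
    proof -
      have "bdd_above (range (\<lambda>x. norm (iter_deriv js ?\<phi> x)))"
        by (rule bdd_aboveI2) (rule bd[OF that])
      then have "norm (iter_deriv js ?\<phi> 0) \<le> (SUP x. norm (iter_deriv js ?\<phi> x))"
        by (rule cSUP_upper[OF UNIV_I])
      then have "0 \<le> (SUP x. norm (iter_deriv js ?\<phi> x))"
        by (rule order_trans[OF norm_ge_zero])
      moreover have "(SUP x. norm (iter_deriv js ?\<phi> x)) \<le> D js * B"
        using bd[OF that] by (intro cSUP_least) auto
      ultimately show ?thesis by simp
    qed
    have "norm (f ?\<phi>) \<le> C * (\<Sum>js\<in>?J. SUP x. norm (iter_deriv js ?\<phi> x))"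
      by (rule Ck) (auto intro!: test_functions_mult_left \<psi> v fun_support_mono)
    also have "\<dots> \<le> \<bar>C\<bar> * (\<Sum>js\<in>?J. SUP x. norm (iter_deriv js ?\<phi> x))"
      using SUP by (intro mult_right_mono sum_nonneg) auto
    also have "\<dots> \<le> \<bar>C\<bar> * (\<Sum>js\<in>?J. D js * B)"
      using SUP by (intro mult_left_mono sum_mono) auto
    finally show "norm (f ?\<phi>) \<le> \<bar>C\<bar> * sum D ?J * B"
      by (simp add: sum_distrib_right mult.assoc)
  qed
qed

text \<open>Each derivative contributes a factor -2 pi i \<xi>_j. Bounding it by 2 pi (1 + |\<xi>|),
  which is at least 1, gives one bound for all orders up to k.\<close>

lemma iter_deriv_wave_bound:
  assumes "length js \<le> k"
  shows "norm (iter_deriv js (wave \<xi>) x) \<le> (2 * pi * (1 + norm \<xi>)) ^ k"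
proof -
  have "\<exists>c. iter_deriv js (wave \<xi>) = (\<lambda>x. c * wave \<xi> x) \<and> norm c \<le> (2 * pi * (1 + norm \<xi>)) ^ length js"
  proof (induction js)
    case Nil
    then show ?case by (intro exI[of _ 1]) simp
  next
    case (Cons j js)
    then obtain c where c: "iter_deriv js (wave \<xi>) = (\<lambda>x. c * wave \<xi> x)"
      "norm c \<le> (2 * pi * (1 + norm \<xi>)) ^ length js" by blast
    let ?d = "- 2 * complex_of_real pi * \<i> * of_real (\<xi> $ j)"
    have "iter_deriv (j # js) (wave \<xi>) = (\<lambda>x. (c * ?d) * wave \<xi> x)"
      by (simp add: iter_deriv_Cons c partial_deriv_mult partial_deriv_const partial_deriv_wave
          smooth_differentiable mult.assoc)
    moreover have d: "norm ?d \<le> 2 * pi * (1 + norm \<xi>)"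
      using component_le_norm_cart[of \<xi> j] by (auto simp: norm_mult intro: order_trans)
    have "norm (c * ?d) \<le> (2 * pi * (1 + norm \<xi>)) ^ length (j # js)"
      unfolding norm_mult[of c] length_Cons power_Suc2 by (rule mult_mono[OF c(2) d]) auto
    ultimately show ?case by blast
  qed
  then have "norm (iter_deriv js (wave \<xi>) x) \<le> (2 * pi * (1 + norm \<xi>)) ^ length js"
    by (auto simp: norm_mult)
  also have "\<dots> \<le> (2 * pi * (1 + norm \<xi>)) ^ k"
  proof (rule power_increasing[OF assms])
    have "1 * 1 \<le> (2 * pi) * (1 + norm \<xi>)"
      using pi_gt3 by (intro mult_mono) auto
    then show "1 \<le> 2 * pi * (1 + norm \<xi>)" by simp
  qed
  finally show ?thesis .
qed

section \<open>Fourier coefficients of test functions\<close>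

text \<open>The integral transform of functions, in contrast to \<open>fourier\<close>, which acts
  on functionals.\<close>

definition ft :: "(real^'d::finite \<Rightarrow> complex) \<Rightarrow> real^'d \<Rightarrow> complex" where
  "ft u \<eta> = integral UNIV (\<lambda>x. u x * wave \<eta> x)"

lemma integral_UNIV_eq_cbox:
  assumes "fun_support u \<subseteq> cbox a b"
  shows "integral UNIV u = integral (cbox a b) u"
proof -
  have "(\<lambda>x. if x \<in> cbox a b then u x else 0) = u"
    using assms fun_support_superset[of u] by (intro ext) (auto split: if_splits)
  then show ?thesis
    using integral_restrict_UNIV[of "cbox a b" u] by simp
qed

lemma test_function_integrable:
  assumes "u \<in> test_functions \<Omega>"
  shows "u integrable_on UNIV"
proof -
  obtain a b where "fun_support u \<subseteq> cbox a b"
    using bounded_subset_cbox_symmetric[OF compact_imp_bounded[OF test_functions_compact[OF assms]]] by blast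
  moreover have "u integrable_on cbox a b"
    by (intro integrable_continuous smooth_continuous_on test_functions_smooth[OF assms])
  ultimately show ?thesis
    by (elim integrable_on_superset) (auto intro: not_in_fun_support)
qed

lemma smooth_has_derivative: "smooth u \<Longrightarrow> (u has_derivative frechet_derivative u (at x)) (at x)"
  using frechet_derivative_works smooth_differentiable by blast

text \<open>The integral of a translate of u along a coordinate axis does not depend on the
  translation; differentiating this constant at 0 under the integral sign gives the claim, without
  iterated integrals.\<close>

lemma integral_partial_deriv:
  fixes u :: "real^'d::finite \<Rightarrow> complex"
  assumes u: "u \<in> test_functions \<Omega>"
  shows "integral UNIV (partial_deriv j u) = 0"
proof -
  let ?e = "axis j 1 :: real^'d"
  have s: "smooth u" using u by (rule test_functions_smooth)
  obtain r where r: "\<And>x. x \<in> fun_support u \<Longrightarrow> norm x \<le> r"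
    using compact_imp_bounded[OF test_functions_compact[OF u]] unfolding bounded_iff by blast
  \<comment> \<open>The margin 1 keeps the support in the box for all translations of length at most
    1.\<close>
  define b :: "real^'d" where "b = (\<chi> i. r + 1)"
  have K: "fun_support u \<subseteq> cbox (- b + t *\<^sub>R ?e) (b + t *\<^sub>R ?e)" if "\<bar>t\<bar> \<le> 1" for t
  proof
    fix x assume "x \<in> fun_support u"
    then have le: "\<bar>x $ i\<bar> \<le> r" for i
      using r component_le_norm_cart[of x i] by (meson order_trans)
    have "\<bar>(t *\<^sub>R ?e) $ i\<bar> \<le> 1" for i
      using that by (simp add: axis_def)
    with le show "x \<in> cbox (- b + t *\<^sub>R ?e) (b + t *\<^sub>R ?e)"
      unfolding mem_box_cart b_def by (simp add: abs_le_iff) (smt (verit))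
  qed
  have const: "integral (cbox (- b) b) (\<lambda>x. u (x + t *\<^sub>R ?e)) = integral UNIV u" if "\<bar>t\<bar> \<le> 1" for t
    using integral_shift_cbox_plus[of "-b" b u "t *\<^sub>R ?e"] integral_UNIV_eq_cbox[OF K[OF that]]
    by (simp add: o_def add.commute)
  have "((\<lambda>t. integral (cbox (- b) b) (\<lambda>x. u (x + t *\<^sub>R ?e))) has_vector_derivative
      integral (cbox (- b) b) (\<lambda>x. partial_deriv j u (x + 0 *\<^sub>R ?e))) (at 0 within {-1<..<1})"
  proof (rule leibniz_rule_vector_derivative)
    fix t :: real and x :: "real^'d"
    have "((\<lambda>t. x + t *\<^sub>R ?e) has_derivative (\<lambda>h. h *\<^sub>R ?e)) (at t)"
      by (auto intro!: derivative_eq_intros)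
    from has_derivative_compose[OF this smooth_has_derivative[OF s]]
    have "((\<lambda>t. u (x + t *\<^sub>R ?e)) has_vector_derivative partial_deriv j u (x + t *\<^sub>R ?e)) (at t)"
      unfolding has_vector_derivative_def partial_deriv_def
      using linear_scale[OF has_derivative_linear[OF smooth_has_derivative[OF s]]] by simp
    then show "((\<lambda>t. u (x + t *\<^sub>R ?e)) has_vector_derivative partial_deriv j u (x + t *\<^sub>R ?e)) (at t within {-1<..<1})"
      by (rule has_vector_derivative_at_within)
  next
    show "(\<lambda>x. u (x + t *\<^sub>R ?e)) integrable_on cbox (- b) b" for t
      by (intro integrable_continuous continuous_on_compose2[OF smooth_continuous_on[OF s, of UNIV]]
          continuous_intros) auto
    show "continuous_on ({-1<..<1} \<times> cbox (- b) b) (\<lambda>(t, x). partial_deriv j u (x + t *\<^sub>R ?e))"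
      unfolding split_def
      by (intro continuous_on_compose2[OF smooth_continuous_on[OF smooth_partial_deriv[OF s], of UNIV]]
          continuous_intros) auto
  qed auto
  then have "((\<lambda>t. integral (cbox (- b) b) (\<lambda>x. u (x + t *\<^sub>R ?e))) has_vector_derivative
      integral (cbox (- b) b) (partial_deriv j u)) (at 0)"
    by (simp add: at_within_open[of 0 "{-1<..<1}"])
  moreover have "((\<lambda>t. integral (cbox (- b) b) (\<lambda>x. u (x + t *\<^sub>R ?e))) has_vector_derivative 0) (at 0)"
    by (rule has_vector_derivative_transform_within_open[of "\<lambda>_. integral UNIV u" _ _ "{-1<..<1}"])
      (auto intro!: const[symmetric])
  ultimately have "integral (cbox (- b) b) (partial_deriv j u) = 0"
    by (rule vector_derivative_unique_at)
  moreover have "fun_support (partial_deriv j u) \<subseteq> cbox (- b) b"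
    using K[of 0] partial_deriv_support[of j u] by auto
  ultimately show ?thesis
    by (simp add: integral_UNIV_eq_cbox)
qed

lemma ft_partial_deriv:
  assumes u: "u \<in> test_functions \<Omega>"
  shows "ft (partial_deriv j u) \<eta> = 2 * of_real pi * \<i> * of_real (\<eta> $ j) * ft u \<eta>"
proof -
  let ?c = "- 2 * complex_of_real pi * \<i> * of_real (\<eta> $ j)"
  have s: "smooth u" using u by (rule test_functions_smooth)
  have i1: "(\<lambda>x. partial_deriv j u x * wave \<eta> x) integrable_on UNIV"
    by (rule test_function_integrable[OF test_functions_mult_left[OF test_functions_partial_deriv[OF u] smooth_wave]])
  have i2: "(\<lambda>x. u x * wave \<eta> x) integrable_on UNIV"
    by (rule test_function_integrable[OF test_functions_mult_left[OF u smooth_wave]])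
  have "partial_deriv j (\<lambda>x. u x * wave \<eta> x) =
      (\<lambda>x. partial_deriv j u x * wave \<eta> x + ?c * (u x * wave \<eta> x))"
    by (simp add: partial_deriv_mult smooth_differentiable s partial_deriv_wave mult_ac)
  then have "integral UNIV (\<lambda>x. partial_deriv j u x * wave \<eta> x + ?c * (u x * wave \<eta> x)) = 0"
    using integral_partial_deriv[OF test_functions_mult_left[OF u smooth_wave], of j \<eta>] by metis
  moreover have "integral UNIV (\<lambda>x. partial_deriv j u x * wave \<eta> x + ?c * (u x * wave \<eta> x)) =
      ft (partial_deriv j u) \<eta> + ?c * ft u \<eta>"
    unfolding ft_def integral_add[OF i1 integrable_on_mult_right[OF i2]] by simp
  ultimately show ?thesis
    by (simp add: add_eq_0_iff2 eq_neg_iff_add_eq_0 algebra_simps)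
qed

text \<open>On both sides each derivative contributes the factor -2 pi i \<eta>_j. This identifies
  the Fourier series of a derivative of u with the termwise derivative of the series of u.\<close>

lemma ft_iter_deriv:
  assumes u: "u \<in> test_functions \<Omega>"
  shows "ft (iter_deriv js u) (- \<eta>) * wave \<eta> x = ft u (- \<eta>) * iter_deriv js (wave \<eta>) x"
proof (induction js arbitrary: x)
  case (Cons j js)
  let ?c = "- 2 * complex_of_real pi * \<i> * of_real (\<eta> $ j)"
  have "ft (iter_deriv (j # js) u) (- \<eta>) * wave \<eta> x = ?c * (ft (iter_deriv js u) (- \<eta>) * wave \<eta> x)"
    by (simp add: iter_deriv_Cons ft_partial_deriv[OF test_functions_iter_deriv[OF u]])
  also have "\<dots> = partial_deriv j (\<lambda>x. ft (iter_deriv js u) (- \<eta>) * wave \<eta> x) x"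
    by (simp add: partial_deriv_mult partial_deriv_const partial_deriv_wave smooth_differentiable)
  also have "\<dots> = partial_deriv j (\<lambda>x. ft u (- \<eta>) * iter_deriv js (wave \<eta>) x) x"
    by (simp add: Cons)
  also have "\<dots> = ft u (- \<eta>) * iter_deriv (j # js) (wave \<eta>) x"
    by (simp add: partial_deriv_mult partial_deriv_const iter_deriv_Cons smooth_differentiable smooth_iter_deriv)
  finally show ?case .
qed simp

text \<open>One more power of 1 + |\<eta>| comes from |\<eta>| \<le> \<Sum>|\<eta>_j|, since
  |\<eta>_j| times the transform of u is dominated by the transform of a partial derivative, to
  which the induction hypothesis applies.\<close>

lemma ft_decay:
  fixes u :: "real^'d::finite \<Rightarrow> complex"
  assumes "u \<in> test_functions \<Omega>"
  shows "\<exists>C\<ge>0. \<forall>\<eta>. norm (ft u \<eta>) \<le> C / (1 + norm \<eta>) ^ N"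
  using assms
proof (induction N arbitrary: u)
  case 0
  obtain a b where ab: "fun_support u \<subseteq> cbox a b"
    using bounded_subset_cbox_symmetric[OF compact_imp_bounded[OF test_functions_compact[OF 0]]] by blast
  obtain C where C: "C \<ge> 0" "\<And>x. norm (u x) \<le> C"
    using test_functions_bounded[OF 0] by blast
  have "norm (ft u \<eta>) \<le> C * measure lborel (cbox a b)" for \<eta>
  proof (rule has_integral_bound[OF C(1)])
    have "fun_support (\<lambda>x. u x * wave \<eta> x) \<subseteq> cbox a b"
      using ab fun_support_mono[of "\<lambda>x. u x * wave \<eta> x" u] by auto
    then have "ft u \<eta> = integral (cbox a b) (\<lambda>x. u x * wave \<eta> x)"
      unfolding ft_def by (rule integral_UNIV_eq_cbox)
    moreover have "(\<lambda>x. u x * wave \<eta> x) integrable_on cbox a b"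
      by (intro integrable_continuous smooth_continuous_on smooth_mult smooth_wave test_functions_smooth[OF 0])
    ultimately show "((\<lambda>x. u x * wave \<eta> x) has_integral ft u \<eta>) (cbox a b)"
      by (simp add: integrable_integral)
    show "norm (u x * wave \<eta> x) \<le> C" for x
      using C by (simp add: norm_mult)
  qed
  moreover have "C * measure lborel (cbox a b) \<ge> 0" using C by simp
  ultimately show ?case by auto
next
  case (Suc N)
  obtain C where C: "C \<ge> 0" "\<And>\<eta>. norm (ft u \<eta>) \<le> C / (1 + norm \<eta>) ^ N"
    using Suc by blast
  have "\<exists>D. \<forall>j. D j \<ge> 0 \<and> (\<forall>\<eta>. norm (ft (partial_deriv j u) \<eta>) \<le> D j / (1 + norm \<eta>) ^ N)"
    using Suc.IH[OF test_functions_partial_deriv[OF Suc.prems]] by metis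
  then obtain D where D: "\<And>j. D j \<ge> 0" "\<And>j \<eta>. norm (ft (partial_deriv j u) \<eta>) \<le> D j / (1 + norm \<eta>) ^ N"
    by blast
  have "norm (ft u \<eta>) \<le> (C + sum D UNIV) / (1 + norm \<eta>) ^ Suc N" for \<eta>
  proof -
    have "\<bar>\<eta> $ j\<bar> * norm (ft u \<eta>) \<le> D j / (1 + norm \<eta>) ^ N" for j
    proof -
      have "\<bar>\<eta> $ j\<bar> * norm (ft u \<eta>) \<le> 2 * pi * (\<bar>\<eta> $ j\<bar> * norm (ft u \<eta>))"
        using pi_gt3 by (intro mult_right_mono[of 1 "2 * pi", simplified]) auto
      also have "\<dots> = norm (ft (partial_deriv j u) \<eta>)"
        by (simp add: ft_partial_deriv[OF Suc.prems] norm_mult)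
      finally show ?thesis using D(2)[of j \<eta>] by linarith
    qed
    then have "(\<Sum>j\<in>UNIV. \<bar>\<eta> $ j\<bar> * norm (ft u \<eta>)) \<le> (\<Sum>j\<in>UNIV. D j / (1 + norm \<eta>) ^ N)"
      by (rule sum_mono)
    moreover have "norm \<eta> * norm (ft u \<eta>) \<le> (\<Sum>j\<in>UNIV. \<bar>\<eta> $ j\<bar>) * norm (ft u \<eta>)"
      by (intro mult_right_mono norm_le_l1_cart) auto
    ultimately have "norm \<eta> * norm (ft u \<eta>) \<le> sum D UNIV / (1 + norm \<eta>) ^ N"
      by (simp add: sum_distrib_right sum_divide_distrib)
    then have "(1 + norm \<eta>) * norm (ft u \<eta>) \<le> (C + sum D UNIV) / (1 + norm \<eta>) ^ N"
      using C(2)[of \<eta>] by (simp add: distrib_right add_divide_distrib)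
    moreover have "1 + norm \<eta> > 0" by (simp add: add_pos_nonneg)
    ultimately have "norm (ft u \<eta>) \<le> (C + sum D UNIV) / (1 + norm \<eta>) ^ N / (1 + norm \<eta>)"
      by (metis mult.commute pos_le_divide_eq)
    then show ?thesis
      by (simp add: mult.commute)
  qed
  moreover have "C + sum D UNIV \<ge> 0" using C D by (simp add: sum_nonneg)
  ultimately show ?case by blast
qed

text \<open>Lebesgue measure is the image of a product measure indexed by \<open>Basis\<close>.
  Renaming coordinates along j \<mapsto> \<open>axis j 1\<close> reduces the claim to the product
  formula for independent variables.\<close>

lemma lborel_integral_prod_cart:
  fixes g :: "'d::finite \<Rightarrow> real \<Rightarrow> complex"
  assumes int: "\<And>j. integrable lborel (g j)"
  shows "integral\<^sup>L lborel (\<lambda>x::real^'d. \<Prod>j\<in>UNIV. g j (x $ j)) = (\<Prod>j\<in>UNIV. integral\<^sup>L lborel (g j))"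
proof -
  interpret product_sigma_finite "\<lambda>_::real^'d. lborel :: real measure"
    by standard
  have bij: "bij_betw (\<lambda>j. axis j 1) UNIV (Basis :: (real^'d) set)"
    by (auto simp: bij_betw_def inj_on_def axis_eq_axis Basis_vec_def)
  have meas: "(\<lambda>x::real^'d. g j (x $ j)) \<in> borel_measurable borel" for j
  proof -
    have "(\<lambda>x::real^'d. x $ j) \<in> borel \<rightarrow>\<^sub>M borel"
      by (intro borel_measurable_continuous_onI continuous_intros)
    moreover have "g j \<in> borel \<rightarrow>\<^sub>M borel"
      using borel_measurable_integrable[OF int[of j]] by simp
    ultimately show ?thesis by (rule measurable_compose)
  qed
  have coord: "(\<Sum>b\<in>Basis. f b *\<^sub>R b) $ j = f (axis j 1)" for f :: "real^'d \<Rightarrow> real" and j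
  proof -
    have "(\<Sum>b\<in>Basis. f b *\<^sub>R b) \<bullet> axis j 1 = f (axis j 1)"
      by (rule inner_sum_left_Basis) simp
    then show ?thesis by (simp add: inner_axis)
  qed
  have "integral\<^sup>L lborel (\<lambda>x::real^'d. \<Prod>j\<in>UNIV. g j (x $ j)) =
      (\<integral>f. (\<Prod>j\<in>UNIV. g j ((\<Sum>b\<in>Basis. f b *\<^sub>R b) $ j)) \<partial>(\<Pi>\<^sub>M b\<in>(Basis::(real^'d) set). lborel))"
    by (subst lborel_eq, subst integral_distr) (auto intro!: borel_measurable_prod meas)
  also have "\<dots> = (\<integral>f. (\<Prod>b\<in>Basis. g (axis_index b) (f b)) \<partial>(\<Pi>\<^sub>M b\<in>(Basis::(real^'d) set). lborel))"
  proof -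
    have "(\<Prod>j\<in>UNIV. g j ((\<Sum>b\<in>Basis. f b *\<^sub>R b) $ j)) = (\<Prod>b\<in>Basis. g (axis_index b) (f b))"
      for f :: "real^'d \<Rightarrow> real"
      by (subst prod.reindex_bij_betw[OF bij, symmetric]) (simp only: coord axis_index_axis)
    then show ?thesis by simp
  qed
  also have "\<dots> = (\<Prod>b\<in>(Basis::(real^'d) set). integral\<^sup>L lborel (g (axis_index b)))"
    by (rule product_integral_prod) (auto intro: int)
  also have "\<dots> = (\<Prod>j\<in>UNIV. integral\<^sup>L lborel (g j))"
    by (subst prod.reindex_bij_betw[OF bij, symmetric]) simp
  finally show ?thesis .
qed

section \<open>Cubes and orthogonality of lattice waves\<close>

definition closed_cube :: "real \<Rightarrow> real^'d::finite \<Rightarrow> (real^'d) set" where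
  "closed_cube L a = cbox (a - (\<chi> j. L / 2)) (a + (\<chi> j. L / 2))"

lemma mem_closed_cube: "x \<in> closed_cube L a \<longleftrightarrow> (\<forall>j. \<bar>x $ j - a $ j\<bar> \<le> L / 2)"
  unfolding closed_cube_def mem_box_cart 
  by (rule all_cong1) (simp only: vector_minus_component vector_add_component vec_lambda_beta, arith)

lemma mem_cube: "x \<in> cube L a \<longleftrightarrow> (\<forall>j. \<bar>x $ j - a $ j\<bar> < L / 2)"
  unfolding cube_def mem_Collect_eq by (rule all_cong1) arith

lemma cube_subset_closed_cube: "cube L a \<subseteq> closed_cube L a"
  by (auto simp: mem_cube mem_closed_cube less_imp_le)

lemma closed_cube_measure_pos: "L > 0 \<Longrightarrow> 0 < measure lborel (closed_cube L a)"
  unfolding closed_cube_def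
  by (rule content_pos_lt) (auto simp: Basis_vec_def inner_axis algebra_simps)

lemma integer_points_add: "m \<in> integer_points \<Longrightarrow> n \<in> integer_points \<Longrightarrow> m + n \<in> integer_points"
  and integer_points_minus: "m \<in> integer_points \<Longrightarrow> - m \<in> integer_points"
  and integer_points_0: "0 \<in> integer_points"
  by (auto simp: integer_points_def)

text \<open>The antiderivative takes equal values at both ends, because L is a period of the
  exponential. The exponent has the shape of the factors in \<open>wave_prod\<close>.\<close>

lemma integral_exp_period:
  assumes L: "L > 0" and k: "k \<in> \<int>" "k \<noteq> 0" and ab: "b = a + L"
  shows "integral {a..b} (\<lambda>t. exp (of_real (t * (k / L)) * (- 2 * of_real pi * \<i>))) = 0"
proof -
  define c where "c = of_real (k / L) * (- 2 * of_real pi * \<i>)"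
  have c: "c \<noteq> 0" using assms by (simp add: c_def)
  have "((\<lambda>t. exp (of_real t * c)) has_integral (exp (of_real b * c) / c - exp (of_real a * c) / c)) {a..b}"
  proof (rule fundamental_theorem_of_calculus)
    show "a \<le> b" using L ab by simp
    fix t
    have "((\<lambda>z. exp (z * c) / c) has_field_derivative exp (of_real t * c)) (at (of_real t))"
      using c by (auto intro!: derivative_eq_intros)
    then show "((\<lambda>t. exp (of_real t * c) / c) has_vector_derivative exp (of_real t * c)) (at t within {a..b})"
      by (rule has_vector_derivative_real_field)
  qed
  moreover have "exp (of_real b * c) = exp (of_real a * c)"
  proof -
    obtain m where m: "k = of_int m" using k Ints_cases by blast
    have "of_real L * c = of_int (- m) * (2 * of_real pi * \<i>)"
      using L by (simp add: c_def m field_simps)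
    then have "exp (of_real L * c) = 1"
      by (metis exp_two_pi_i exp_power_int power_int_1_left)
    then show ?thesis
      by (simp add: ab distrib_right exp_add)
  qed
  ultimately have "integral {a..b} (\<lambda>t. exp (of_real t * c)) = 0"
    by (auto intro: integral_unique)
  then show ?thesis by (simp add: c_def mult.assoc)
qed

lemma wave_prod: "wave \<xi> x = (\<Prod>j\<in>UNIV. exp (of_real (x $ j * \<xi> $ j) * (- 2 * of_real pi * \<i>)))"
  unfolding wave_def
  by (subst exp_sum[symmetric])
    (simp_all add: inner_vec_def of_real_sum sum_distrib_left sum_distrib_right sum_negf mult_ac)

text \<open>Both the indicator of the cube and the wave factor over the coordinates, hence so does
  the integral; a coordinate with n_j \<noteq> 0 contributes the factor 0.\<close>

lemma integral_wave:
  fixes a n :: "real^'d::finite"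
  assumes L: "L > 0" and n: "n \<in> integer_points" "n \<noteq> 0"
  shows "integral (closed_cube L a) (wave ((1 / L) *\<^sub>R n)) = 0"
proof -
  let ?Q = "closed_cube L a"
  let ?E = "\<lambda>j t. exp (of_real (t * (n $ j / L)) * (- 2 * complex_of_real pi * \<i>))"
  let ?I = "\<lambda>j. {a $ j - L / 2 .. a $ j + L / 2}"
  let ?g = "\<lambda>j t. indicator (?I j) t *\<^sub>R ?E j t"
  have int1: "set_integrable lborel (?I j) (?E j)" for j
    unfolding set_integrable_def
    by (intro borel_integrable_compact continuous_intros) auto
  have "set_integrable lborel ?Q (wave ((1 / L) *\<^sub>R n))"
    unfolding set_integrable_def closed_cube_def
    by (intro borel_integrable_compact smooth_continuous_on smooth_wave) auto
  from set_borel_integral_eq_integral(2)[OF this]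
  have "integral ?Q (wave ((1 / L) *\<^sub>R n)) = (\<integral>x. indicator ?Q x *\<^sub>R wave ((1 / L) *\<^sub>R n) x \<partial>lborel)"
    by (simp add: set_lebesgue_integral_def)
  also have "\<dots> = (\<integral>x. (\<Prod>j\<in>UNIV. ?g j (x $ j)) \<partial>lborel)"
  proof -
    have "indicator ?Q x *\<^sub>R wave ((1 / L) *\<^sub>R n) x = (\<Prod>j\<in>UNIV. ?g j (x $ j))" for x
    proof (cases "x \<in> ?Q")
      case True
      then have "\<bar>x $ j - a $ j\<bar> \<le> L / 2" for j
        by (simp only: mem_closed_cube)
      then have "x $ j \<in> ?I j" for j
        unfolding atLeastAtMost_iff by (smt (verit, best))
      then show ?thesis using True by (simp add: wave_prod)
    next
      case False
      then obtain j where "\<not> \<bar>x $ j - a $ j\<bar> \<le> L / 2"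
        by (auto simp only: mem_closed_cube)
      then have "x $ j \<notin> ?I j"
        unfolding atLeastAtMost_iff by (smt (verit, best))
      then have "?g j (x $ j) = 0" by simp
      then have "(\<Prod>j\<in>UNIV. ?g j (x $ j)) = 0"
        by (intro prod_zero) (auto intro!: exI[of _ j])
      then show ?thesis using False by simp
    qed
    then show ?thesis by simp
  qed
  also have "\<dots> = (\<Prod>j\<in>UNIV. integral\<^sup>L lborel (?g j))"
    using int1 by (intro lborel_integral_prod_cart) (simp add: set_integrable_def)
  also have "\<dots> = 0"
  proof -
    obtain j where j: "n $ j \<noteq> 0" using n(2) by (auto simp: vec_eq_iff)
    have "integral\<^sup>L lborel (?g j) = integral (?I j) (?E j)"
      using set_borel_integral_eq_integral(2)[OF int1[of j]] by (simp add: set_lebesgue_integral_def)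
    also have "\<dots> = 0"
      using n(1) j L by (intro integral_exp_period) (auto simp: integer_points_def)
    finally show ?thesis by (intro prod_zero) auto
  qed
  finally show ?thesis .
qed

section \<open>Fourier inversion on a cube\<close>

inductive_set trig_polys :: "real \<Rightarrow> (real^'d::finite \<Rightarrow> complex) set" for L where
  wave: "n \<in> integer_points \<Longrightarrow> (\<lambda>x. c * wave ((1 / L) *\<^sub>R n) x) \<in> trig_polys L"
| add: "p \<in> trig_polys L \<Longrightarrow> q \<in> trig_polys L \<Longrightarrow> (\<lambda>x. p x + q x) \<in> trig_polys L"

lemma trig_polys_const: "(\<lambda>x. c) \<in> trig_polys L"
  using trig_polys.wave[OF integer_points_0, of c L] by simp

lemma trig_polys_wave_mult:
  assumes "p \<in> trig_polys L" "n \<in> integer_points"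
  shows "(\<lambda>x. c * wave ((1 / L) *\<^sub>R n) x * p x) \<in> trig_polys L"
  using assms(1)
proof induction
  case (wave m d)
  have "(\<lambda>x. (c * d) * wave ((1 / L) *\<^sub>R (n + m)) x) \<in> trig_polys L"
    using wave assms(2) by (intro trig_polys.wave integer_points_add)
  then show ?case
    by (simp add: scaleR_add_right wave_add mult_ac)
next
  case (add p q)
  then show ?case
    using trig_polys.add[OF add.IH] by (simp add: distrib_left)
qed

lemma trig_polys_mult:
  assumes "p \<in> trig_polys L" "q \<in> trig_polys L"
  shows "(\<lambda>x. p x * q x) \<in> trig_polys L"
  using assms(1)
proof induction
  case (wave n c)
  then show ?case using trig_polys_wave_mult[OF assms(2)] by simp
next
  case (add p1 p2)
  then show ?case
    using trig_polys.add[OF add.IH] by (simp add: distrib_right)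
qed

lemma trig_polys_cnj:
  assumes "p \<in> trig_polys L"
  shows "(\<lambda>x. cnj (p x)) \<in> trig_polys L"
  using assms
proof induction
  case (wave n c)
  then show ?case
    using trig_polys.wave[OF integer_points_minus[OF wave], of "cnj c" L] by (simp add: cnj_wave)
next
  case (add p q)
  then show ?case using trig_polys.add[OF add.IH] by simp
qed

lemma trig_polys_sum:
  "(\<And>i. i \<in> I \<Longrightarrow> p i \<in> trig_polys L) \<Longrightarrow> (\<lambda>x. \<Sum>i\<in>I. p i x) \<in> trig_polys L"
  by (induction I rule: infinite_finite_induct) (auto intro: trig_polys_const trig_polys.add)

lemma trig_polys_diff:
  assumes "p \<in> trig_polys L" "q \<in> trig_polys L"
  shows "(\<lambda>x. p x - q x) \<in> trig_polys L"
  using trig_polys.add[OF assms(1) trig_polys_mult[OF trig_polys_const[of "-1"] assms(2)]] by simp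

lemma trig_polys_continuous_on: "p \<in> trig_polys L \<Longrightarrow> continuous_on A p"
  by (induction rule: trig_polys.induct)
    (auto intro!: continuous_on_add continuous_on_mult continuous_on_const
      intro: smooth_continuous_on[OF smooth_wave])

text \<open>Wraps the cube around the torus in complex space by gluing opposite faces; polynomials
  in the torus coordinates and their conjugates pull back to trigonometric polynomials.\<close>

definition torus_map :: "real \<Rightarrow> real^'d::finite \<Rightarrow> real^'d \<Rightarrow> complex^'d" where
  "torus_map L a x = (\<chi> j. cis (2 * pi * (x $ j - a $ j) / L))"

text \<open>Inverts \<open>torus_map\<close> on the open cube. Since \<open>Arg\<close> takes values
  in the half-open interval from -pi to pi, with pi included, glued faces return to the upper
  face.\<close>

definition torus_inv :: "real \<Rightarrow> real^'d::finite \<Rightarrow> complex^'d \<Rightarrow> real^'d" where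
  "torus_inv L a z = (\<chi> j. a $ j + L / (2 * pi) * Arg (z $ j))"

lemma torus_map_trig_poly: "(\<lambda>x. torus_map L a x $ j) \<in> trig_polys L"
proof -
  \<comment> \<open>The frequency is negative because of the minus sign in \<open>wave\<close>; the
    coefficient chosen below accounts for the centre a.\<close>
  have "axis j (-1) \<in> (integer_points :: (real^'a) set)"
    by (auto simp: integer_points_def axis_def)
  from trig_polys.wave[OF this, of "cis (- 2 * pi * a $ j / L)" L]
  show ?thesis
    by (simp add: torus_map_def wave_def inner_axis' cis_conv_exp flip: exp_add)
      (simp add: algebra_simps diff_divide_distrib)
qed

text \<open>A real-linear functional is a combination of the real and imaginary parts of the
  coordinates, that is, of (z + cnj z)/2 and (z - cnj z)/(2i), and the conjugate of a wave is again
  a wave. Sums and products stay in the algebra.\<close>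

lemma real_polynomial_torus_map:
  assumes "real_polynomial_function q"
  shows "(\<lambda>x. of_real (q (torus_map L a x)) :: complex) \<in> trig_polys L"
  using assms
proof induction
  case (linear q)
  let ?E = "torus_map L a"
  have "q z = (\<Sum>j\<in>UNIV. Re (z $ j) * q (axis j 1) + Im (z $ j) * q (axis j \<i>))" for z
  proof -
    have "z = (\<Sum>j\<in>UNIV. Re (z $ j) *\<^sub>R axis j 1 + Im (z $ j) *\<^sub>R axis j \<i>)"
      by (simp add: vec_eq_iff axis_def complex_eq_iff if_distrib if_distribR sum.delta' sum.distrib
          cong: if_cong)
    then have "q z = q (\<Sum>j\<in>UNIV. Re (z $ j) *\<^sub>R axis j 1 + Im (z $ j) *\<^sub>R axis j \<i>)" by simp
    also have "\<dots> = (\<Sum>j\<in>UNIV. Re (z $ j) * q (axis j 1) + Im (z $ j) * q (axis j \<i>))"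
      using bounded_linear.linear[OF linear]
      by (simp add: linear_sum linear_add linear_scale)
    finally show ?thesis .
  qed
  note q_eq = this
  have "(\<lambda>x. of_real (q (?E x)) :: complex) = (\<lambda>x. \<Sum>j\<in>UNIV.
      of_real (q (axis j 1)) * (1 / 2) * (?E x $ j + cnj (?E x $ j)) +
      of_real (q (axis j \<i>)) * (1 / (2 * \<i>)) * (?E x $ j - cnj (?E x $ j)))"
    by (rule ext, subst q_eq) (simp add: complex_add_cnj complex_diff_cnj mult_ac)
  then show ?case
    by (simp only:) (intro trig_polys_sum trig_polys.add trig_polys_diff trig_polys_mult
        trig_polys_const trig_polys_cnj torus_map_trig_poly)
next
  case (const c)
  show ?case by (rule trig_polys_const)
next
  case (add f g)
  then show ?case using trig_polys.add[OF add.IH] by simp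
next
  case (mult f g)
  then show ?case using trig_polys_mult[OF mult.IH] by simp
qed

text \<open>The distance |x_j - a_j| attains its maximum on the compact support, and a maximum
  attained inside the open cube is strictly below L/2.\<close>

lemma test_function_cube_margin:
  fixes a :: "real^'d::finite"
  assumes w: "w \<in> test_functions (cube L a)" and L: "L > 0"
  obtains c where "0 \<le> c" "c < L / 2" "\<And>x. w x \<noteq> 0 \<Longrightarrow> \<bar>x $ j - a $ j\<bar> \<le> c"
proof (cases "fun_support w = {}")
  case True
  then have "w x = 0" for x
    using fun_support_superset[of w x] by auto
  then show thesis using that[of 0] L by simp
next
  case False
  have "\<exists>y\<in>fun_support w. \<forall>x\<in>fun_support w. \<bar>x $ j - a $ j\<bar> \<le> \<bar>y $ j - a $ j\<bar>"
    using test_functions_compact[OF w] False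
    by (intro continuous_attains_sup continuous_intros)
  then obtain y where y: "y \<in> fun_support w"
    "\<And>x. x \<in> fun_support w \<Longrightarrow> \<bar>x $ j - a $ j\<bar> \<le> \<bar>y $ j - a $ j\<bar>" by blast
  have "\<bar>y $ j - a $ j\<bar> < L / 2"
    using y(1) test_functions_support[OF w] mem_cube by blast
  then show thesis
    using that[of "\<bar>y $ j - a $ j\<bar>"] y(2) fun_support_superset by fastforce
qed

text \<open>The principal argument jumps where a coordinate is \<open>-1\<close>, but there the lifted function vanishes
  because the support of \<open>w\<close> stays away from the boundary of the cube.\<close>

lemma torus_lift_continuous:
  fixes a :: "real^'d::finite"
  assumes w: "w \<in> test_functions (cube L a)" and L: "L > 0"
  shows "continuous_on {z. \<forall>j. norm (z $ j) = 1} (\<lambda>z. w (torus_inv L a z))"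
  unfolding continuous_on_eq_continuous_within
proof
  let ?S = "{z. \<forall>j. norm (z $ j) = 1}"
  fix z :: "complex^'d" assume z: "z \<in> ?S"
  show "continuous (at z within ?S) (\<lambda>z. w (torus_inv L a z))"
  proof (cases "\<forall>j. z $ j \<notin> \<real>\<^sub>\<le>\<^sub>0")
    case True
    have "isCont (torus_inv L a) z"
      unfolding torus_inv_def isCont_def
      by (intro vec_tendstoI) (simp, intro tendsto_intros, use True in auto)
    moreover have "isCont w (torus_inv L a z)"
      using smooth_continuous_on[OF test_functions_smooth[OF w], of UNIV]
      by (simp add: continuous_on_eq_continuous_at)
    ultimately have "isCont (\<lambda>z. w (torus_inv L a z)) z"
      by (rule isCont_o2)
    then show ?thesis
      by (rule continuous_at_imp_continuous_within)
  next
    case False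
    then obtain j where j: "z $ j \<in> \<real>\<^sub>\<le>\<^sub>0" by blast
    obtain c where c: "0 \<le> c" "c < L / 2" "\<And>x. w x \<noteq> 0 \<Longrightarrow> \<bar>x $ j - a $ j\<bar> \<le> c"
      using test_function_cube_margin[OF w L] by metis
    \<comment> \<open>The angle on the circle that corresponds to the distance c. A point of the
      circle with real part below cos \<theta> has an argument larger than \<theta> in absolute
      value, so it returns to a place where w vanishes; these points form a neighbourhood of
      -1.\<close>
    define \<theta> where "\<theta> = 2 * pi * c / L"
    have \<theta>: "0 \<le> \<theta>" "\<theta> < pi"
      using c L by (simp_all add: \<theta>_def field_simps)
    have zero: "w (torus_inv L a y) = 0" if y: "y \<in> ?S" "Re (y $ j) < cos \<theta>" for y
    proof (rule ccontr)
      assume "w (torus_inv L a y) \<noteq> 0"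
      then have "\<bar>torus_inv L a y $ j - a $ j\<bar> \<le> c" by (rule c(3))
      then have "L / (2 * pi) * \<bar>Arg (y $ j)\<bar> \<le> c"
        using L by (simp add: torus_inv_def abs_mult)
      then have "\<bar>Arg (y $ j)\<bar> \<le> \<theta>"
        using L by (simp add: \<theta>_def field_simps)
      then have "cos \<theta> \<le> cos \<bar>Arg (y $ j)\<bar>"
        using \<theta> by (intro cos_monotone_0_pi_le) auto
      moreover have "cis (Arg (y $ j)) = y $ j"
        using y(1) complex_norm_eq_1_exp_eq[of "y $ j"] by (simp add: cis_conv_exp)
      then have "Re (y $ j) = cos (Arg (y $ j))"
        by (metis cis.sel(1))
      ultimately show False using y(2) by simp
    qed
    have "z $ j = -1"
    proof -
      obtain r where r: "z $ j = of_real r" "r \<le> 0"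
        using j by (auto simp: nonpos_Reals_def)
      moreover have "norm (z $ j) = 1" using z by blast
      ultimately have "r = -1" by simp
      with r show ?thesis by simp
    qed
    moreover have "cos pi < cos \<theta>"
      using \<theta> by (intro cos_monotone_0_pi) auto
    ultimately have zU: "z \<in> {y. Re (y $ j) < cos \<theta>}" by simp
    have "open {y :: complex^'d. Re (y $ j) < cos \<theta>}"
      by (intro open_Collect_less continuous_intros)
    then have "eventually (\<lambda>y. w (torus_inv L a y) = 0) (at z within ?S)"
      unfolding eventually_at_topological using zU zero
      by (intro exI[of _ "{y. Re (y $ j) < cos \<theta>}"]) simp
    then have "((\<lambda>y. w (torus_inv L a y)) \<longlongrightarrow> 0) (at z within ?S)"
      by (rule tendsto_eventually)
    then show ?thesis
      using zero[OF z] zU by (simp add: continuous_within)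
  qed
qed

text \<open>Stone-Weierstrass approximates the lift of w on the compact torus by a polynomial, which
  is pulled back to the cube. The pullback reproduces w even on the boundary, where
  \<open>torus_inv\<close> may return to another point.\<close>

lemma trig_poly_approx:
  fixes a :: "real^'d::finite"
  assumes w: "w \<in> test_functions (cube L a)" and L: "L > 0" and e: "\<epsilon> > 0"
  obtains p where "p \<in> trig_polys L" "\<And>x. x \<in> closed_cube L a \<Longrightarrow> norm (w x - p x) < \<epsilon>"
proof -
  let ?S = "{z::complex^'d. \<forall>j. norm (z $ j) = 1}"
  have "compact ?S"
  proof -
    have "closed ?S"
      by (intro closed_Collect_all closed_Collect_eq continuous_intros)
    moreover have "norm z \<le> real CARD('d)" if "z \<in> ?S" for z :: "complex^'d"
      using L2_set_le_sum[of UNIV "\<lambda>j. norm (z $ j)"] that by (simp add: norm_vec_def)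
    then have "bounded ?S" unfolding bounded_iff by blast
    ultimately show ?thesis by (simp add: compact_eq_bounded_closed)
  qed
  from Stone_Weierstrass_polynomial_function[OF this torus_lift_continuous[OF w L] e]
  obtain g where g: "polynomial_function g" "\<And>z. z \<in> ?S \<Longrightarrow> norm (w (torus_inv L a z) - g z) < \<epsilon>"
    by blast
  have "(\<lambda>x. of_real (Re (g (torus_map L a x))) + \<i> * of_real (Im (g (torus_map L a x)))) \<in> trig_polys L"
    using g(1) bounded_linear_Re bounded_linear_Im unfolding polynomial_function_def o_def
    by (intro trig_polys.add trig_polys_mult trig_polys_const real_polynomial_torus_map) blast+
  then have "(\<lambda>x. g (torus_map L a x)) \<in> trig_polys L"
    by (simp flip: complex_eq)
  moreover have "norm (w x - g (torus_map L a x)) < \<epsilon>" if x: "x \<in> closed_cube L a" for x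
  proof -
    have "w (torus_inv L a (torus_map L a x)) = w x"
    proof (cases "x \<in> cube L a")
      case True
      have "torus_inv L a (torus_map L a x) $ j = x $ j" for j
      proof -
        have "\<bar>x $ j - a $ j\<bar> < L / 2" using True mem_cube by blast
        then have "2 * pi / L * \<bar>x $ j - a $ j\<bar> < 2 * pi / L * (L / 2)"
          using L by (intro mult_strict_left_mono) auto
        then have "\<bar>2 * pi * (x $ j - a $ j) / L\<bar> < pi"
          using L by (simp add: abs_mult)
        then have "2 * pi * (x $ j - a $ j) / L \<in> {- pi<..pi}"
          unfolding abs_less_iff greaterThanAtMost_iff by linarith
        then show ?thesis
          using L by (simp add: torus_inv_def torus_map_def Arg_cis)
      qed
      then have "torus_inv L a (torus_map L a x) = x" by (simp add: vec_eq_iff)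
      then show ?thesis by simp
    next
      case False
      then obtain j where "\<not> \<bar>x $ j - a $ j\<bar> < L / 2" using mem_cube by blast
      moreover have "\<bar>x $ j - a $ j\<bar> \<le> L / 2" using x mem_closed_cube by blast
      ultimately have "x $ j - a $ j = L / 2 \<or> x $ j - a $ j = - (L / 2)" by linarith
      \<comment> \<open>Both faces go to -1, whose argument is pi, so the way back ends at a_j +
        L/2. That point lies outside the open cube, as x does, and w vanishes at both.\<close>
      moreover have "cis (2 * pi * d / L) = cis pi" if "d = L / 2 \<or> d = - (L / 2)" for d
        using that L by (auto simp: complex_eq_iff)
      ultimately have "cis (2 * pi * (x $ j - a $ j) / L) = cis pi" by blast
      then have "torus_inv L a (torus_map L a x) $ j = a $ j + L / 2"
        by (simp add: torus_inv_def torus_map_def Arg_cis del: cis_pi)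
      then have "torus_inv L a (torus_map L a x) \<notin> cube L a"
        using L by (auto simp: mem_cube intro!: exI[of _ j])
      moreover have "w y = 0" if "y \<notin> cube L a" for y
        using that test_functions_support[OF w] fun_support_superset[of w y] by blast
      ultimately show ?thesis using False by simp
    qed
    moreover have "torus_map L a x \<in> ?S"
      by (simp add: torus_map_def)
    ultimately show ?thesis using g(2) by fastforce
  qed
  ultimately show thesis by (rule that)
qed

section \<open>Summability over the lattice\<close>

lemma summable_one_over_square_int: "(\<lambda>k::int. 1 / (1 + \<bar>real_of_int k\<bar>) ^ 2) summable_on UNIV"
proof -
  have "summable (\<lambda>n. 1 / (real (Suc n)) ^ 2)"
    using inverse_power_summable[of 2, where 'a = real] summable_Suc_iff[of "\<lambda>n. inverse (real n ^ 2)"]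
    by (simp add: inverse_eq_divide)
  then have "(\<lambda>n. 1 / (real (Suc n)) ^ 2) summable_on UNIV"
    by (rule summable_nonneg_imp_summable_on) auto
  then have nat: "(\<lambda>n. 1 / (1 + real n) ^ 2) summable_on UNIV"
    by (simp add: add.commute)
  have pos: "(\<lambda>k::int. 1 / (1 + \<bar>real_of_int k\<bar>) ^ 2) summable_on range int"
    using nat by (subst summable_on_reindex) (auto simp: o_def)
  have neg: "(\<lambda>k::int. 1 / (1 + \<bar>real_of_int k\<bar>) ^ 2) summable_on range (\<lambda>n. - int n)"
    using nat by (subst summable_on_reindex) (auto simp: o_def inj_on_def)
  have "(UNIV :: int set) = range int \<union> range (\<lambda>n. - int n)"
    by (auto intro: int_cases2)
  then show ?thesis
    using summable_on_union[OF pos neg] by simp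
qed

text \<open>Since |n_j| \<le> |n|, the exponent 2 CARD('d) can be shared out as one square (1 +
  |n_j|)^2 per coordinate. A finite set of lattice points embeds into a box of integers, over which
  the resulting product sums to a power of a one-dimensional sum.\<close>

lemma summable_integer_points:
  "(\<lambda>n::real^'d::finite. 1 / (1 + norm n) ^ (2 * CARD('d))) summable_on integer_points"
proof (rule nonneg_bdd_above_summable_on)
  let ?g = "\<lambda>k::int. 1 / (1 + \<bar>real_of_int k\<bar>) ^ 2"
  have "(\<Sum>n\<in>F. 1 / (1 + norm n) ^ (2 * CARD('d))) \<le> (infsum ?g UNIV) ^ CARD('d)"
    if F: "F \<subseteq> integer_points" "finite F" for F :: "(real^'d) set"
  proof -
    let ?r = "\<lambda>n j. \<lfloor>(n::real^'d) $ j\<rfloor>"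
    \<comment> \<open>K collects all coordinates of all points of F, so that F embeds into the
      functions from coordinates to K.\<close>
    define K where "K = (\<Union>n\<in>F. range (?r n))"
    have fK: "finite K" unfolding K_def using F(2) by auto
    have n: "n $ j = of_int (?r n j)" if "n \<in> F" for n j
      using F(1) that by (auto simp: integer_points_def Ints_def)
    have inj: "inj_on ?r F"
      by (rule inj_onI) (metis (no_types, lifting) n vec_eq_iff)
    have "(\<Sum>n\<in>F. 1 / (1 + norm n) ^ (2 * CARD('d))) \<le> (\<Sum>n\<in>F. \<Prod>j\<in>UNIV. ?g (?r n j))"
    proof (rule sum_mono)
      fix n assume nF: "n \<in> F"
      have "(\<Prod>j\<in>(UNIV::'d set). 1 / (1 + norm n) ^ 2) \<le> (\<Prod>j\<in>UNIV. ?g (?r n j))"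
      proof (rule prod_mono)
        fix j
        have "\<bar>real_of_int (?r n j)\<bar> \<le> norm n"
          using component_le_norm_cart[of n j] n[OF nF, of j] by simp
        then show "0 \<le> 1 / (1 + norm n) ^ 2 \<and> 1 / (1 + norm n) ^ 2 \<le> ?g (?r n j)"
          by (intro conjI divide_left_mono power_mono mult_pos_pos zero_less_power add_pos_nonneg) auto
      qed
      then show "1 / (1 + norm n) ^ (2 * CARD('d)) \<le> (\<Prod>j\<in>UNIV. ?g (?r n j))"
        by (simp add: power_mult power_one_over)
    qed
    also have "\<dots> = (\<Sum>h\<in>?r ` F. \<Prod>j\<in>UNIV. ?g (h j))"
      by (simp add: sum.reindex[OF inj])
    also have "\<dots> \<le> (\<Sum>h\<in>PiE (UNIV::'d set) (\<lambda>_. K). \<Prod>j\<in>UNIV. ?g (h j))"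
    proof (rule sum_mono2)
      show "?r ` F \<subseteq> PiE UNIV (\<lambda>_. K)" by (auto simp: K_def)
    qed (auto intro!: finite_PiE fK prod_nonneg)
    also have "\<dots> = (\<Prod>j\<in>(UNIV::'d set). \<Sum>k\<in>K. ?g k)"
      by (rule prod_sum_PiE[symmetric]) (auto intro: fK)
    also have "\<dots> = (\<Sum>k\<in>K. ?g k) ^ CARD('d)" by simp
    also have "\<dots> \<le> (infsum ?g UNIV) ^ CARD('d)"
      by (intro power_mono finite_sum_le_infsum summable_one_over_square_int fK sum_nonneg) auto
    finally show ?thesis .
  qed
  then show "bdd_above (sum (\<lambda>n::real^'d. 1 / (1 + norm n) ^ (2 * CARD('d))) ` {F. F \<subseteq> integer_points \<and> finite F})"
    by (intro bdd_aboveI2) auto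
qed auto

text \<open>Rescaling by 1/L costs at most a factor max 1 L for each power.\<close>

lemma summable_lattice:
  assumes L: "L > 0"
  shows "(\<lambda>n::real^'d::finite. 1 / (1 + norm ((1 / L) *\<^sub>R n)) ^ (2 * CARD('d))) summable_on integer_points"
proof (rule summable_on_comparison_test)
  let ?c = "(max 1 L) ^ (2 * CARD('d))"
  show "(\<lambda>n::real^'d. ?c * (1 / (1 + norm n) ^ (2 * CARD('d)))) summable_on integer_points"
    by (intro summable_on_cmult_right summable_integer_points)
  fix n :: "real^'d"
  have "1 + norm n \<le> max 1 L * (1 + norm ((1 / L) *\<^sub>R n))"
  proof -
    have "norm n = L * norm ((1 / L) *\<^sub>R n)" using L by simp
    also have "\<dots> \<le> max 1 L * norm ((1 / L) *\<^sub>R n)" by (intro mult_right_mono) auto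
    finally show ?thesis unfolding distrib_left by (intro add_mono) auto
  qed
  then have "(1 + norm n) ^ (2 * CARD('d)) \<le> (max 1 L * (1 + norm ((1 / L) *\<^sub>R n))) ^ (2 * CARD('d))"
    by (intro power_mono) auto
  moreover have "1 + norm n > 0" "1 + norm ((1 / L) *\<^sub>R n) > 0"
    by (simp_all add: add_pos_nonneg del: norm_scaleR)
  ultimately show "1 / (1 + norm ((1 / L) *\<^sub>R n)) ^ (2 * CARD('d)) \<le> ?c * (1 / (1 + norm n) ^ (2 * CARD('d)))"
    by (simp add: power_mult_distrib divide_simps del: norm_scaleR)
qed auto

section \<open>Convergence of the Fourier series to the function\<close>

text \<open>Orthogonality to a fixed continuous function survives uniform approximation of the other
  factor. In \<open>fourier_inversion\<close> the approximated factor is first the difference of w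
  and its Fourier series, then the conjugate of that difference.\<close>

lemma integral_eq_0_of_approx:
  fixes h :: "'a::euclidean_space \<Rightarrow> complex"
  assumes h: "continuous_on (cbox a b) h"
    and q: "\<And>\<epsilon>. \<epsilon> > 0 \<Longrightarrow> \<exists>q. continuous_on (cbox a b) q \<and>
      (\<forall>x\<in>cbox a b. norm (g x - q x) \<le> \<epsilon>) \<and> integral (cbox a b) (\<lambda>x. h x * q x) = 0"
    and g: "continuous_on (cbox a b) g"
  shows "integral (cbox a b) (\<lambda>x. h x * g x) = 0"
proof -
  let ?Q = "cbox a b"
  have "compact (h ` ?Q)" by (intro compact_continuous_image h compact_cbox)
  then obtain M where M: "M > 0" "\<And>x. x \<in> ?Q \<Longrightarrow> norm (h x) \<le> M"
    using compact_imp_bounded bounded_pos by (metis imageI)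
  have "norm (integral ?Q (\<lambda>x. h x * g x)) \<le> \<epsilon>" if e: "\<epsilon> > 0" for \<epsilon>
  proof -
    let ?V = "measure lborel ?Q"
    \<comment> \<open>M bounds h, and the summand 1 keeps the denominator positive for a box of
      volume 0.\<close>
    define \<delta> where "\<delta> = \<epsilon> / (M * (?V + 1))"
    have V: "?V + 1 > 0" by (simp add: add_nonneg_pos)
    have \<delta>: "\<delta> > 0" using e M V unfolding \<delta>_def by (intro divide_pos_pos mult_pos_pos) auto
    obtain q where q: "continuous_on ?Q q" "\<And>x. x \<in> ?Q \<Longrightarrow> norm (g x - q x) \<le> \<delta>"
      "integral ?Q (\<lambda>x. h x * q x) = 0" using assms(2)[OF \<delta>] by blast
    have i: "(\<lambda>x. h x * g x) integrable_on ?Q" "(\<lambda>x. h x * q x) integrable_on ?Q"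
      by (intro integrable_continuous continuous_intros h g q(1))+
    have "integral ?Q (\<lambda>x. h x * g x) = integral ?Q (\<lambda>x. h x * g x - h x * q x)"
      using integral_diff[OF i] q(3) by simp
    also have "norm \<dots> \<le> (M * \<delta>) * ?V"
    proof (rule has_integral_bound[OF _ integrable_integral[OF integrable_diff[OF i]]])
      show "norm (h x * g x - h x * q x) \<le> M * \<delta>" if "x \<in> ?Q" for x
      proof -
        have "norm (h x * g x - h x * q x) = norm (h x) * norm (g x - q x)"
          by (simp add: norm_mult flip: right_diff_distrib)
        also have "\<dots> \<le> M * \<delta>" using M q(2) that by (intro mult_mono) auto
        finally show ?thesis .
      qed
    qed (use M \<delta> in auto)
    also have "\<dots> \<le> (M * \<delta>) * (?V + 1)"
      using M \<delta> by (intro mult_left_mono) auto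
    also have "\<dots> = \<epsilon>"
      using M V by (simp add: \<delta>_def)
    finally show ?thesis .
  qed
  then show ?thesis
    by (metis dense_ge norm_le_zero_iff)
qed

text \<open>Decay of the coefficients makes the series converge uniformly to a continuous s. The
  difference h = w - s has vanishing Fourier coefficients, hence is orthogonal to all trigonometric
  polynomials, but on the cube it is itself a uniform limit of such polynomials. So the integral of
  |h|^2 is 0, and h vanishes by continuity.\<close>

theorem fourier_inversion:
  fixes a :: "real^'d::finite"
  assumes w: "w \<in> test_functions (cube L a)" and L: "L > 0" and x: "x \<in> closed_cube L a"
  shows "((\<lambda>n. ft w (- ((1 / L) *\<^sub>R n)) / measure lborel (closed_cube L a) * wave ((1 / L) *\<^sub>R n) x) has_sum w x)
    integer_points"
proof -
  let ?Z = "integer_points :: (real^'d) set" and ?Q = "closed_cube L a"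
  let ?l = "\<lambda>n::real^'d. (1 / L) *\<^sub>R n"
  let ?V = "measure lborel ?Q"
  have V: "?V > 0" by (rule closed_cube_measure_pos[OF L])
  define c where "c n = ft w (- ?l n) / ?V" for n
  obtain C where C: "C \<ge> 0" "\<And>\<eta>. norm (ft w \<eta>) \<le> C / (1 + norm \<eta>) ^ (2 * CARD('d))"
    using ft_decay[OF w] by blast
  let ?M = "\<lambda>n. (C / ?V) * (1 / (1 + norm (?l n)) ^ (2 * CARD('d)))"
  have cM: "norm (c n) \<le> ?M n" for n
    using C(2)[of "- ?l n"] V by (simp add: c_def norm_divide field_simps)
  have sumM: "?M summable_on ?Z"
    by (intro summable_on_cmult_right summable_lattice L)
  define s where "s x = (\<Sum>\<^sub>\<infinity>n\<in>?Z. c n * wave (?l n) x)" for x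
  let ?s = "\<lambda>F x. \<Sum>n\<in>F. c n * wave (?l n) x"
  have unif: "uniform_limit UNIV ?s s (finite_subsets_at_top ?Z)"
    unfolding s_def by (rule Weierstrass_m_test_general[OF _ sumM]) (simp only: norm_mult norm_wave mult_1_right cM)
  have sum_s: "((\<lambda>n. c n * wave (?l n) x) has_sum s x) ?Z" for x
    using tendsto_uniform_limitI[OF unif, of x] by (simp add: has_sum_def)
  have conts: "continuous_on ?Q s"
  proof (rule uniform_limit_theorem)
    show "\<forall>\<^sub>F F in finite_subsets_at_top ?Z. continuous_on ?Q (?s F)"
      by (intro always_eventually allI continuous_intros smooth_continuous_on smooth_wave)
    show "uniform_limit ?Q ?s s (finite_subsets_at_top ?Z)"
      by (rule uniform_limit_on_subset[OF unif]) auto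
  qed auto
  \<comment> \<open>The set G serves to force a chosen frequency into the partial sum.\<close>
  have approx_s: "\<exists>F. finite F \<and> F \<subseteq> ?Z \<and> G \<subseteq> F \<and> (\<forall>x. norm (s x - ?s F x) < \<epsilon>)"
    if "\<epsilon> > 0" "finite G" "G \<subseteq> ?Z" for \<epsilon> G
  proof -
    have "\<forall>\<^sub>F F in finite_subsets_at_top ?Z. (\<forall>x\<in>UNIV. dist (?s F x) (s x) < \<epsilon>) \<and> (finite F \<and> G \<subseteq> F \<and> F \<subseteq> ?Z)"
      using uniform_limitD[OF unif that(1)] eventually_finite_subsets_at_top_finite
      by (intro eventually_conj) (use that in \<open>auto simp: eventually_finite_subsets_at_top\<close>)
    then obtain F where "\<forall>x\<in>UNIV. dist (?s F x) (s x) < \<epsilon>" "finite F" "G \<subseteq> F" "F \<subseteq> ?Z"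
      using eventually_happens'[OF finite_subsets_at_top_neq_bot] by blast
    then show ?thesis by (auto simp: dist_norm norm_minus_commute intro!: exI[of _ F])
  qed
  have contw: "continuous_on ?Q w"
    by (rule smooth_continuous_on[OF test_functions_smooth[OF w]])
  define h where "h x = w x - s x" for x
  have conth: "continuous_on ?Q h"
    unfolding h_def by (intro continuous_intros contw conts)
  have integrable_cube: "p integrable_on ?Q" if "continuous_on ?Q p" for p :: "real^'d \<Rightarrow> complex"
    using that unfolding closed_cube_def by (rule integrable_continuous)
  have contwave: "continuous_on ?Q (wave \<eta>)" for \<eta>
    by (intro smooth_continuous_on smooth_wave)
  have int_wave: "integral ?Q (\<lambda>x. wave (?l n) x * wave (?l k) x) = (if n = - k then ?V else 0)"
    if "n \<in> ?Z" "k \<in> ?Z" for n k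
  proof -
    have "(\<lambda>x. wave (?l n) x * wave (?l k) x) = wave (?l (n + k))"
      by (simp add: fun_eq_iff scaleR_add_right wave_add)
    moreover have "integral ?Q (wave (?l (n + k))) = (if n + k = 0 then of_real ?V else 0)"
      using integral_wave[OF L integer_points_add[OF that]] 
      by (auto simp: closed_cube_def wave_0[abs_def] scaleR_conv_of_real)
    ultimately show ?thesis by (simp add: eq_neg_iff_add_eq_0)
  qed
  have orth: "integral ?Q (\<lambda>x. h x * wave (?l k) x) = 0" if k: "k \<in> ?Z" for k
  proof -
    have iw: "integral ?Q (\<lambda>x. w x * wave (?l k) x) = ft w (?l k)"
      unfolding ft_def closed_cube_def
      by (rule integral_UNIV_eq_cbox[symmetric])
        (use test_functions_support[OF w] cube_subset_closed_cube[of L a] fun_support_mono[of "\<lambda>x. w x * wave (?l k) x" w] in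
          \<open>auto simp: closed_cube_def\<close>)
    \<comment> \<open>The pairing is bilinear, without conjugation, so the wave of index k selects
      the coefficient of index -k, which F must therefore contain.\<close>
    have is_eq: "integral ?Q (\<lambda>x. ?s F x * wave (?l k) x) = ft w (?l k)"
      if F: "finite F" "F \<subseteq> ?Z" "{-k} \<subseteq> F" for F
    proof -
      have "integral ?Q (\<lambda>x. ?s F x * wave (?l k) x) = integral ?Q (\<lambda>x. \<Sum>n\<in>F. c n * (wave (?l n) x * wave (?l k) x))"
        by (simp add: sum_distrib_right mult.assoc)
      also have "\<dots> = (\<Sum>n\<in>F. c n * integral ?Q (\<lambda>x. wave (?l n) x * wave (?l k) x))"
        by (subst integral_sum) (auto intro!: F(1) integrable_cube continuous_intros contwave)
      also have "\<dots> = (\<Sum>n\<in>F. if n = - k then c n * ?V else 0)"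
        using F(2) k by (intro sum.cong refl, subst int_wave) auto
      also have "\<dots> = c (- k) * ?V" using F by simp
      also have "\<dots> = ft w (?l k)" using V by (simp add: c_def)
      finally show ?thesis .
    qed
    have "integral ?Q (\<lambda>x. wave (?l k) x * h x) = 0"
      unfolding closed_cube_def
    proof (rule integral_eq_0_of_approx; fold closed_cube_def)
      fix \<epsilon> :: real assume "\<epsilon> > 0"
      then obtain F where F: "finite F" "F \<subseteq> ?Z" "{-k} \<subseteq> F" "\<And>x. norm (s x - ?s F x) < \<epsilon>"
        using approx_s[of \<epsilon> "{-k}"] k by (auto simp: integer_points_minus)
      have cF: "continuous_on ?Q (?s F)" by (intro continuous_intros contwave)
      have "integral ?Q (\<lambda>x. w x * wave (?l k) x - ?s F x * wave (?l k) x) = 0"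
        using iw is_eq[OF F(1-3)]
        by (subst integral_diff) (auto intro!: integrable_cube continuous_intros contw contwave cF)
      then have "integral ?Q (\<lambda>x. wave (?l k) x * (w x - ?s F x)) = 0"
        by (simp add: algebra_simps)
      moreover have "norm (h x - (w x - ?s F x)) \<le> \<epsilon>" for x
        using F(4)[of x] by (simp add: h_def norm_minus_commute)
      ultimately show "\<exists>q. continuous_on ?Q q \<and> (\<forall>x\<in>?Q. norm (h x - q x) \<le> \<epsilon>) \<and>
          integral ?Q (\<lambda>x. wave (?l k) x * q x) = 0"
        by (intro exI[of _ "\<lambda>x. w x - ?s F x"]) (auto intro!: continuous_intros contw cF)
    qed (intro contwave conth)+
    then show ?thesis by (simp add: mult.commute)
  qed
  have orth_poly: "integral ?Q (\<lambda>x. h x * p x) = 0" if "p \<in> trig_polys L" for p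
    using that
  proof induction
    case (wave n d)
    have "integral ?Q (\<lambda>x. h x * (d * wave (?l n) x)) = d * integral ?Q (\<lambda>x. h x * wave (?l n) x)"
      by (subst integral_mult_right[symmetric]) (simp add: mult_ac)
    then show ?case using orth[OF wave] by simp
  next
    case (add p q)
    have "(\<lambda>x. h x * p x) integrable_on ?Q" "(\<lambda>x. h x * q x) integrable_on ?Q"
      by (intro integrable_cube continuous_on_mult conth trig_polys_continuous_on[where L = L] add.hyps)+
    from integral_add[OF this] show ?case using add.IH by (simp add: distrib_left)
  qed
  \<comment> \<open>\<open>h\<close> is orthogonal to all trigonometric polynomials, and these approximate \<open>cnj h\<close> uniformly\<close>
  have "integral ?Q (\<lambda>x. h x * cnj (h x)) = 0"
    unfolding closed_cube_def
  proof (rule integral_eq_0_of_approx; fold closed_cube_def)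
    fix \<epsilon> :: real assume e: "\<epsilon> > 0"
    obtain p where p: "p \<in> trig_polys L" "\<And>x. x \<in> ?Q \<Longrightarrow> norm (w x - p x) < \<epsilon> / 2"
      using trig_poly_approx[OF w L, of "\<epsilon> / 2"] e by auto
    obtain F where F: "finite F" "F \<subseteq> ?Z" "\<And>x. norm (s x - ?s F x) < \<epsilon> / 2"
      using approx_s[of "\<epsilon> / 2" "{}"] e by auto
    have q: "(\<lambda>x. cnj (p x - ?s F x)) \<in> trig_polys L"
      using F(2) by (intro trig_polys_cnj trig_polys_diff p(1) trig_polys_sum trig_polys.wave) auto
    have le: "norm (cnj (h x) - cnj (p x - ?s F x)) \<le> \<epsilon>" if "x \<in> ?Q" for x
    proof -
      have "cnj (h x) - cnj (p x - ?s F x) = cnj ((w x - p x) - (s x - ?s F x))"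
        by (simp add: h_def)
      then have "norm (cnj (h x) - cnj (p x - ?s F x)) = norm ((w x - p x) - (s x - ?s F x))"
        by (simp only: complex_mod_cnj)
      then show ?thesis
        using p(2)[OF that] F(3)[of x] norm_triangle_ineq4[of "w x - p x" "s x - ?s F x"] by linarith
    qed
    show "\<exists>q. continuous_on ?Q q \<and> (\<forall>x\<in>?Q. norm (cnj (h x) - q x) \<le> \<epsilon>) \<and>
        integral ?Q (\<lambda>x. h x * q x) = 0"
      by (intro exI[of _ "\<lambda>x. cnj (p x - ?s F x)"] conjI ballI le
          trig_polys_continuous_on[OF q] orth_poly[OF q])
  qed (intro continuous_intros conth)+
  then have "integral ?Q (\<lambda>x. complex_of_real ((norm (h x))\<^sup>2)) = 0"
    by (simp only: complex_norm_square)
  moreover have "integral ?Q (\<lambda>x. complex_of_real ((norm (h x))\<^sup>2)) = of_real (integral ?Q (\<lambda>x. (norm (h x))\<^sup>2))"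
  proof -
    have "(\<lambda>x. (norm (h x))\<^sup>2) integrable_on ?Q"
      unfolding closed_cube_def by (intro integrable_continuous continuous_intros conth[unfolded closed_cube_def])
    from integral_linear[OF this bounded_linear_of_real[where 'a = complex]]
    show ?thesis by (simp add: o_def)
  qed
  ultimately have "integral ?Q (\<lambda>x. (norm (h x))\<^sup>2) = 0" by simp
  moreover have "continuous_on ?Q (\<lambda>x. (norm (h x))\<^sup>2)"
    by (intro continuous_on_power continuous_on_norm conth)
  \<comment> \<open>A nonempty interior makes a continuous nonnegative function with integral 0
    vanish at every point of the closed cube.\<close>
  moreover have "box (a - (\<chi> j. L / 2)) (a + (\<chi> j. L / 2)) \<noteq> {}"
    using L by (auto simp: box_ne_empty Basis_vec_def inner_axis algebra_simps)
  ultimately have "\<forall>y\<in>?Q. (norm (h y))\<^sup>2 = 0"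
    unfolding closed_cube_def by (subst (asm) integral_cbox_eq_0_iff) simp_all
  then have "(norm (h x))\<^sup>2 = 0" using x by blast
  then have "w x = s x" by (simp add: h_def)
  then show ?thesis using sum_s[of x] by (simp add: c_def)
qed

section \<open>Applying a distribution to a Fourier series\<close>

lemma distribution_sum:
  assumes f: "distribution f" and I: "finite I" and u: "\<And>i. i \<in> I \<Longrightarrow> u i \<in> test_functions UNIV"
  shows "f (\<lambda>x. \<Sum>i\<in>I. u i x) = (\<Sum>i\<in>I. f (u i))
    \<and> (\<lambda>x. \<Sum>i\<in>I. u i x) \<in> test_functions UNIV"
  using I u
proof (induction I)
  case empty
  then show ?case by (simp add: distribution_0 f)
next
  case (insert i I)
  then have ui: "u i \<in> test_functions UNIV" and uI: "(\<lambda>x. \<Sum>i\<in>I. u i x) \<in> test_functions UNIV"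
    and eq: "f (\<lambda>x. \<Sum>i\<in>I. u i x) = (\<Sum>i\<in>I. f (u i))" by auto
  have "(\<lambda>x. u i x + (\<Sum>i\<in>I. u i x)) \<in> test_functions UNIV"
  proof (rule test_functionsI)
    show "smooth (\<lambda>x. u i x + (\<Sum>i\<in>I. u i x))"
      using ui uI by (intro smooth_add) (auto dest: test_functions_smooth)
    show "compact (fun_support (u i) \<union> fun_support (\<lambda>x. \<Sum>i\<in>I. u i x))"
      by (intro compact_Un test_functions_compact[OF ui] test_functions_compact[OF uI])
    show "x \<in> fun_support (u i) \<union> fun_support (\<lambda>x. \<Sum>i\<in>I. u i x)"
      if "u i x + (\<Sum>i\<in>I. u i x) \<noteq> 0" for x
    proof (rule ccontr)
      assume "x \<notin> fun_support (u i) \<union> fun_support (\<lambda>x. \<Sum>i\<in>I. u i x)"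
      then have "u i x = 0" "(\<Sum>i\<in>I. u i x) = 0"
        by (auto intro: not_in_fun_support[of x "u i"] not_in_fun_support[of x "\<lambda>x. \<Sum>i\<in>I. u i x"])
      with that show False by simp
    qed
  qed auto
  then show ?case
    using insert.hyps distribution_add[OF f ui uI] eq by simp
qed

text \<open>On the support of \<psi> the distribution has some finite order k, and each derivative
  of a wave costs one factor of size 1 + |\<eta>|.\<close>

lemma distribution_wave_bound:
  assumes f: "distribution f" and \<psi>: "\<psi> \<in> test_functions \<Omega>"
  obtains C k where "C \<ge> 0" "\<And>\<eta>. norm (f (\<lambda>x. \<psi> x * wave \<eta> x)) \<le> C * (1 + norm \<eta>) ^ k"
proof -
  obtain C k where C: "C \<ge> 0" "\<And>v B. smooth v \<Longrightarrow> 0 \<le> B \<Longrightarrow>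
      (\<And>is y. length is \<le> k \<Longrightarrow> y \<in> fun_support \<psi> \<Longrightarrow> norm (iter_deriv is v y) \<le> B) \<Longrightarrow>
      norm (f (\<lambda>x. \<psi> x * v x)) \<le> C * B"
    by (rule distribution_mult_bound[OF f test_functions_UNIV[OF \<psi>]]) blast
  have "norm (f (\<lambda>x. \<psi> x * wave \<eta> x)) \<le> C * (2 * pi * (1 + norm \<eta>)) ^ k" for \<eta>
    by (rule C(2)) (auto intro: iter_deriv_wave_bound)
  then have "norm (f (\<lambda>x. \<psi> x * wave \<eta> x)) \<le> (C * (2 * pi) ^ k) * (1 + norm \<eta>) ^ k" for \<eta>
    by (simp only: power_mult_distrib mult.assoc)
  then show thesis
    using that[of "C * (2 * pi) ^ k" k] C(1) by simp
qed

text \<open>Partial sums of the Fourier series of w approximate w with all derivatives up to the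
  order of f, uniformly on the support of \<psi>. So f (\<psi> w) differs by arbitrarily little from
  a finite sum of terms bounded through H. Outside the cube the series is unrelated to w, but \<psi>
  vanishes there.\<close>

lemma distribution_fourier_bound:
  fixes a :: "real^'d::finite"
  assumes f: "distribution f" and \<psi>: "\<psi> \<in> test_functions (cube L a)"
    and w: "w \<in> test_functions (cube L a)" and L: "L > 0"
    and le: "\<And>n. n \<in> integer_points \<Longrightarrow>
      norm (ft w (- ((1 / L) *\<^sub>R n))) * norm (f (\<lambda>x. \<psi> x * wave ((1 / L) *\<^sub>R n) x)) \<le> H n"
    and H: "H summable_on integer_points"
  shows "norm (f (\<lambda>x. \<psi> x * w x)) \<le> infsum H integer_points / measure lborel (closed_cube L a)"
proof -
  let ?Z = "integer_points :: (real^'d) set" and ?V = "measure lborel (closed_cube L a)"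
  let ?l = "\<lambda>n::real^'d. (1 / L) *\<^sub>R n"
  have V: "?V > 0" by (rule closed_cube_measure_pos[OF L])
  define c where "c n = ft w (- ?l n) / ?V" for n
  obtain C k where C: "C \<ge> 0" "\<And>v B. smooth v \<Longrightarrow> 0 \<le> B \<Longrightarrow>
      (\<And>is y. length is \<le> k \<Longrightarrow> y \<in> fun_support \<psi> \<Longrightarrow> norm (iter_deriv is v y) \<le> B) \<Longrightarrow>
      norm (f (\<lambda>x. \<psi> x * v x)) \<le> C * B"
    by (rule distribution_mult_bound[OF f test_functions_UNIV[OF \<psi>]]) blast
  \<comment> \<open>M n bounds every derivative of order at most k of the n-th term of the
    series.\<close>
  define M where "M n = norm (c n) * (2 * pi * (1 + norm (?l n))) ^ k" for n
  have M0: "M n \<ge> 0" for n by (simp add: M_def)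
  \<comment> \<open>Of these powers, k compensate the derivatives of the wave and 2 CARD('d) remain
    for summation.\<close>
  obtain D where D: "D \<ge> 0" "\<And>\<eta>. norm (ft w \<eta>) \<le> D / (1 + norm \<eta>) ^ (k + 2 * CARD('d))"
    using ft_decay[OF w] by blast
  have M: "M summable_on ?Z"
  proof (rule summable_on_comparison_test)
    let ?K = "D / ?V * (2 * pi) ^ k"
    show "(\<lambda>n. ?K * (1 / (1 + norm (?l n)) ^ (2 * CARD('d)))) summable_on ?Z"
      by (intro summable_on_cmult_right summable_lattice L)
    fix n
    define r where "r = 1 + norm (?l n)"
    have r: "r > 0" by (simp add: r_def add_pos_nonneg del: norm_scaleR)
    have "norm (c n) \<le> D / r ^ (k + 2 * CARD('d)) / ?V"
    proof -
      have "norm (c n) = norm (ft w (- ?l n)) / ?V"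
        using V by (simp add: c_def norm_divide)
      also have "\<dots> \<le> D / r ^ (k + 2 * CARD('d)) / ?V"
        unfolding r_def by (rule divide_right_mono) (use D(2)[of "- ?l n"] V in \<open>simp_all only: norm_minus_cancel less_imp_le\<close>)
      finally show ?thesis .
    qed
    then have "M n \<le> D / r ^ (k + 2 * CARD('d)) / ?V * (2 * pi * r) ^ k"
      unfolding M_def r_def[symmetric] by (rule mult_right_mono) (use r in simp)
    also have "\<dots> = ?K * (1 / r ^ (2 * CARD('d)))"
      using r by (simp add: power_add power_mult_distrib)
    finally show "M n \<le> ?K * (1 / (1 + norm (?l n)) ^ (2 * CARD('d)))"
      unfolding r_def .
  qed (rule M0)
  define S where "S = infsum H ?Z / ?V"
  have "norm (f (\<lambda>x. \<psi> x * w x)) \<le> C * \<epsilon> + S" if e: "\<epsilon> > 0" for \<epsilon>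
  proof -
    obtain F where F: "finite F" "F \<subseteq> ?Z" "dist (sum M F) (infsum M ?Z) \<le> \<epsilon>"
      using has_sum_finite_approximation[OF has_sum_infsum[OF M] e] by blast
    let ?s = "\<lambda>x. \<Sum>n\<in>F. c n * wave (?l n) x"
    have ss: "smooth ?s" by (intro smooth_sum smooth_mult smooth_const smooth_wave)
    have sw: "smooth w" by (rule test_functions_smooth[OF w])
    have "norm (f (\<lambda>x. \<psi> x * (w x - ?s x))) \<le> C * \<epsilon>"
    proof (rule C(2))
      show "smooth (\<lambda>x. w x - ?s x)" by (intro smooth_diff ss sw)
      fix js :: "'d list" and y
      assume js: "length js \<le> k" and y: "y \<in> fun_support \<psi>"
      let ?t = "\<lambda>n. c n * iter_deriv js (wave (?l n)) y"
      have "y \<in> closed_cube L a"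
        using y test_functions_support[OF \<psi>] cube_subset_closed_cube by blast
      \<comment> \<open>Inversion is applied to the derivative of w; \<open>ft_iter_deriv\<close>
        then rewrites its series as the termwise derivative, so no interchange of limit and
        derivative arises.\<close>
      from fourier_inversion[OF test_functions_iter_deriv[OF w] L this, of js]
      have "(?t has_sum iter_deriv js w y) ?Z"
        by (simp only: c_def times_divide_eq_left ft_iter_deriv[OF w])
      from has_sum_Diff[OF this has_sum_finite[OF F(1)] F(2)]
      have t: "(?t has_sum (iter_deriv js w y - sum ?t F)) (?Z - F)" .
      from has_sum_Diff[OF has_sum_infsum[OF M] has_sum_finite[OF F(1)] F(2)]
      have MF: "(M has_sum (infsum M ?Z - sum M F)) (?Z - F)" .
      have "norm (iter_deriv js w y - sum ?t F) \<le> infsum M ?Z - sum M F"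
        by (rule norm_infsum_le[OF t MF])
          (auto simp: norm_mult M_def simp del: norm_scaleR intro!: mult_left_mono iter_deriv_wave_bound js)
      also have "\<dots> \<le> \<epsilon>" using F(3) by (simp add: dist_real_def)
      finally show "norm (iter_deriv js (\<lambda>x. w x - ?s x) y) \<le> \<epsilon>"
        by (simp add: iter_deriv_diff[OF sw ss] iter_deriv_sum iter_deriv_cmult smooth_mult)
    qed (use e in auto)
    moreover have "norm (f (\<lambda>x. \<psi> x * ?s x)) \<le> S"
    proof -
      have "(\<lambda>x. \<psi> x * ?s x) = (\<lambda>x. \<Sum>n\<in>F. c n * (\<psi> x * wave (?l n) x))"
        by (simp add: sum_distrib_left mult_ac)
      moreover have pw: "(\<lambda>x. \<psi> x * wave \<eta> x) \<in> test_functions UNIV" for \<eta>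
        by (intro test_functions_mult_left test_functions_UNIV[OF \<psi>] smooth_wave)
      ultimately have "f (\<lambda>x. \<psi> x * ?s x) = (\<Sum>n\<in>F. c n * f (\<lambda>x. \<psi> x * wave (?l n) x))"
        using distribution_sum[OF f F(1), of "\<lambda>n x. c n * (\<psi> x * wave (?l n) x)"]
        by (simp add: distribution_cmult[OF f pw] test_functions_mult_right[OF pw smooth_const])
      also have "norm \<dots> \<le> (\<Sum>n\<in>F. H n / ?V)"
      proof (rule sum_norm_le)
        show "norm (c n * f (\<lambda>x. \<psi> x * wave (?l n) x)) \<le> H n / ?V" if "n \<in> F" for n
          using le[of n] that F(2) V by (auto simp: c_def norm_mult norm_divide divide_right_mono)
      qed
      also have "\<dots> = sum H F / ?V" by (simp add: sum_divide_distrib)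
      \<comment> \<open>The finite sum is below the infinite one because H, which dominates products
        of norms, is nonnegative.\<close>
      also have "\<dots> \<le> S"
        unfolding S_def using V F(1,2)
        by (intro divide_right_mono finite_sum_le_infsum H)
          (auto intro: order_trans[OF _ le] mult_nonneg_nonneg)
      finally show ?thesis .
    qed
    moreover have "f (\<lambda>x. \<psi> x * w x) = f (\<lambda>x. \<psi> x * (w x - ?s x)) + f (\<lambda>x. \<psi> x * ?s x)"
    proof -
      have "f (\<lambda>x. \<psi> x * (w x - ?s x)) + f (\<lambda>x. \<psi> x * ?s x) = f (\<lambda>x. \<psi> x * (w x - ?s x) + \<psi> x * ?s x)"
        by (rule distribution_add[symmetric])
          (intro f test_functions_mult_left test_functions_UNIV[OF \<psi>] smooth_diff sw ss)+
      then show ?thesis by (simp flip: distrib_left)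
    qed
    ultimately show ?thesis
      using norm_triangle_le by (metis (no_types, lifting) add_mono)
  qed
  note bound = this
  have "norm (f (\<lambda>x. \<psi> x * w x)) \<le> S + \<epsilon>" if "\<epsilon> > 0" for \<epsilon>
  proof -
    \<comment> \<open>Dividing by C + 1 instead of C allows for C = 0.\<close>
    have "norm (f (\<lambda>x. \<psi> x * w x)) \<le> C * (\<epsilon> / (C + 1)) + S"
      by (rule bound) (use C(1) that in simp)
    also have "C * (\<epsilon> / (C + 1)) \<le> (C + 1) * (\<epsilon> / (C + 1))"
      using C(1) that by (intro mult_right_mono) auto
    finally show ?thesis using C(1) by simp
  qed
  then show ?thesis unfolding S_def by (rule field_le_epsilon)
qed

section \<open>Rapid decay in cones\<close>

lemma bracket_ge_1: "1 \<le> bracket x"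
  by (simp add: bracket_def)

lemma bracket_le: "bracket x \<le> 1 + norm x"
  unfolding bracket_def by (rule real_le_lsqrt) (auto simp: power2_eq_square algebra_simps)

lemma le_bracket: "1 + norm x \<le> 2 * bracket x"
proof -
  have "norm x \<le> bracket x"
    unfolding bracket_def by (rule real_le_rsqrt) simp
  then show ?thesis using bracket_ge_1[of x] by simp
qed

text \<open>Natural powers of 1 + |\<xi>| replace real powers of \<open>bracket\<close>, because
  they combine directly with the triangle inequality. \<open>rapid_decay_on_bracket\<close> and
  \<open>rapid_decay_onI\<close> translate between the two forms.\<close>

definition rapid_decay_on :: "(real^'d::finite) set \<Rightarrow> (real^'d \<Rightarrow> complex) \<Rightarrow> bool" where
  "rapid_decay_on S g \<longleftrightarrow> (\<forall>N::nat. \<exists>C. \<forall>\<xi>\<in>S. norm (g \<xi>) \<le> C / (1 + norm \<xi>) ^ N)"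

lemma rapid_decay_on_subset: "rapid_decay_on S g \<Longrightarrow> T \<subseteq> S \<Longrightarrow> rapid_decay_on T g"
  unfolding rapid_decay_on_def by (meson subsetD)

lemma rapid_decay_onE:
  assumes "rapid_decay_on S g"
  obtains C where "C > 0" "\<And>\<xi>. \<xi> \<in> S \<Longrightarrow> norm (g \<xi>) \<le> C / (1 + norm \<xi>) ^ N"
proof -
  obtain C where C: "\<And>\<xi>. \<xi> \<in> S \<Longrightarrow> norm (g \<xi>) \<le> C / (1 + norm \<xi>) ^ N"
    using assms unfolding rapid_decay_on_def by meson
  have "norm (g \<xi>) \<le> (\<bar>C\<bar> + 1) / (1 + norm \<xi>) ^ N" if "\<xi> \<in> S" for \<xi>
    using C[OF that] by (rule order_trans) (auto intro!: divide_right_mono)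
  then show thesis using that[of "\<bar>C\<bar> + 1"] by simp
qed

lemma rapid_decay_on_bracket:
  assumes "rapid_decay_on S g"
  shows "\<exists>C>0. \<forall>\<xi>\<in>S. norm (g \<xi>) \<le> C * bracket \<xi> powr (- N)"
proof -
  \<comment> \<open>For negative N this is 0, which still works because \<open>bracket\<close> is at
    least 1.\<close>
  define m where "m = nat \<lceil>N\<rceil>"
  obtain C where C: "C > 0" "\<And>\<xi>. \<xi> \<in> S \<Longrightarrow> norm (g \<xi>) \<le> C / (1 + norm \<xi>) ^ m"
    using rapid_decay_onE[OF assms] by blast
  have "C / (1 + norm \<xi>) ^ m \<le> C * bracket \<xi> powr (- N)" for \<xi> :: "real^'a"
  proof -
    have b: "1 \<le> bracket \<xi>" by (rule bracket_ge_1)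
    have "bracket \<xi> powr N \<le> bracket \<xi> powr real m"
      using b by (intro powr_mono) (auto simp: m_def real_nat_ceiling_ge)
    also have "\<dots> = bracket \<xi> ^ m"
      using b by (simp add: powr_realpow)
    also have "\<dots> \<le> (1 + norm \<xi>) ^ m"
      using b by (intro power_mono bracket_le) auto
    finally have "C / (1 + norm \<xi>) ^ m \<le> C / bracket \<xi> powr N"
      using C(1) b by (intro divide_left_mono mult_pos_pos) (auto intro!: zero_less_power add_pos_nonneg)
    then show ?thesis by (simp add: powr_minus divide_inverse)
  qed
  then show ?thesis
    using C by (intro exI[of _ C]) (auto intro: order_trans)
qed

text \<open>Positive exponents match the quantifier in \<open>WF\<close>; exponent N is obtained
  from Suc N, which covers N = 0.\<close>

lemma rapid_decay_onI:
  assumes "\<And>N::nat. N > 0 \<Longrightarrow> \<exists>C>0. \<forall>\<xi>\<in>S. norm (g \<xi>) \<le> C * bracket \<xi> powr (- real N)"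
  shows "rapid_decay_on S g"
  unfolding rapid_decay_on_def
proof
  fix N :: nat
  obtain C where C: "C > 0" "\<And>\<xi>. \<xi> \<in> S \<Longrightarrow> norm (g \<xi>) \<le> C * bracket \<xi> powr (- real (Suc N))"
    using assms[of "Suc N"] by blast
  have "C * bracket \<xi> powr (- real (Suc N)) \<le> C * 2 ^ N / (1 + norm \<xi>) ^ N" for \<xi> :: "real^'a"
  proof -
    have b: "1 \<le> bracket \<xi>" by (rule bracket_ge_1)
    have "bracket \<xi> powr (- real (Suc N)) \<le> bracket \<xi> powr (- real N)"
      using b by (intro powr_mono) auto
    also have "\<dots> = 1 / bracket \<xi> ^ N"
      using b by (simp add: powr_minus powr_realpow divide_inverse)
    also have "\<dots> \<le> 1 / ((1 + norm \<xi>) / 2) ^ N"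
      using b le_bracket[of \<xi>]
      by (intro divide_left_mono power_mono mult_pos_pos zero_less_power) (auto intro: add_pos_nonneg)
    also have "\<dots> = 2 ^ N / (1 + norm \<xi>) ^ N"
      by (simp add: power_divide)
    finally have "C * bracket \<xi> powr (- real (Suc N)) \<le> C * (2 ^ N / (1 + norm \<xi>) ^ N)"
      using C(1) by (intro mult_left_mono) auto
    then show ?thesis by simp
  qed
  then show "\<exists>C. \<forall>\<xi>\<in>S. norm (g \<xi>) \<le> C / (1 + norm \<xi>) ^ N"
    using C(2) by (intro exI[of _ "C * 2 ^ N"]) (blast intro: order_trans)
qed

section \<open>Cones and the convolution estimate\<close>

text \<open>The new cone is spanned by a ball of half the radius. The separation condition is
  invariant under scaling, so it need only be checked there: vectors of that ball have norm at most
  R, and \<delta> R \<le> r/2 keeps \<eta> within the original ball. The cap \<delta> \<le> 1 is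
  used in \<open>peetre_far\<close>.\<close>

lemma shrink_cone:
  fixes \<xi>\<^sub>0 :: "real^'d::finite"
  assumes \<Gamma>: "open \<Gamma>" "positive_cone \<Gamma>" "\<xi>\<^sub>0 \<in> \<Gamma>"
  obtains \<Gamma>' \<delta> where "open \<Gamma>'" "positive_cone \<Gamma>'" "\<xi>\<^sub>0 \<in> \<Gamma>'" "0 < \<delta>" "\<delta> \<le> 1"
    "\<And>\<xi> \<eta>. \<xi> \<in> \<Gamma>' \<Longrightarrow> norm (\<eta> - \<xi>) < \<delta> * norm \<xi> \<Longrightarrow> \<eta> \<in> \<Gamma>"
proof -
  obtain r where r: "r > 0" "ball \<xi>\<^sub>0 r \<subseteq> \<Gamma>"
    using \<Gamma> open_contains_ball by blast
  define \<Gamma>' where "\<Gamma>' = (\<Union>t\<in>{0<..}. (*\<^sub>R) t ` ball \<xi>\<^sub>0 (r / 2))"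
  define R where "R = norm \<xi>\<^sub>0 + r"
  have R: "R > 0" using r by (simp add: R_def add_nonneg_pos)
  define \<delta> where "\<delta> = min 1 (r / (2 * R))"
  have \<delta>: "0 < \<delta>" "\<delta> \<le> 1" "\<delta> \<le> r / (2 * R)" using r R by (auto simp: \<delta>_def)
  show thesis
  proof
    show "open \<Gamma>'"
      unfolding \<Gamma>'_def by (intro open_UN ballI open_scaling) auto
    show "positive_cone \<Gamma>'"
      unfolding positive_cone_def
    proof (intro ballI allI impI)
      fix x t assume "x \<in> \<Gamma>'" "(0::real) < t"
      then obtain s y where "s > 0" "y \<in> ball \<xi>\<^sub>0 (r / 2)" "x = s *\<^sub>R y"
        unfolding \<Gamma>'_def by auto
      then show "t *\<^sub>R x \<in> \<Gamma>'"
        unfolding \<Gamma>'_def using \<open>0 < t\<close> by (intro UN_I[of "t * s"]) auto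
    qed
    show "\<xi>\<^sub>0 \<in> \<Gamma>'"
      unfolding \<Gamma>'_def using r by (intro UN_I[of 1]) auto
    show "0 < \<delta>" "\<delta> \<le> 1" by fact+
    fix \<xi> \<eta> assume "\<xi> \<in> \<Gamma>'" and le: "norm (\<eta> - \<xi>) < \<delta> * norm \<xi>"
    then obtain t \<zeta> where t: "t > 0" and "\<zeta> \<in> ball \<xi>\<^sub>0 (r / 2)" and \<xi>: "\<xi> = t *\<^sub>R \<zeta>"
      unfolding \<Gamma>'_def by auto
    then have \<zeta>: "norm (\<zeta> - \<xi>\<^sub>0) < r / 2" by (simp add: dist_norm norm_minus_commute)
    define \<eta>' where "\<eta>' = (1 / t) *\<^sub>R \<eta>"
    have \<eta>: "\<eta> = t *\<^sub>R \<eta>'" using t by (simp add: \<eta>'_def)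
    have "t * norm (\<eta>' - \<zeta>) < t * (\<delta> * norm \<zeta>)"
      using le t unfolding \<xi> \<eta> by (simp add: mult.left_commute flip: scaleR_diff_right)
    then have "norm (\<eta>' - \<zeta>) < \<delta> * norm \<zeta>" using t by simp
    also have "norm \<zeta> \<le> R"
      using norm_triangle_sub[of \<zeta> \<xi>\<^sub>0] \<zeta> r(1) by (simp add: R_def)
    then have "\<delta> * norm \<zeta> \<le> r / (2 * R) * R"
      using \<delta> r R by (intro mult_mono) auto
    also have "\<dots> = r / 2" using R by simp
    finally have "norm (\<eta>' - \<xi>\<^sub>0) < r"
      using \<zeta> norm_triangle_ineq[of "\<eta>' - \<zeta>" "\<zeta> - \<xi>\<^sub>0"] by simp
    then have "\<eta>' \<in> \<Gamma>" using r(2) by (auto simp: dist_norm norm_minus_commute)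
    then show "\<eta> \<in> \<Gamma>" using \<Gamma>(2) t unfolding \<eta> positive_cone_def by blast
  qed
qed

text \<open>Here x, y, z stand for |\<xi>|, |\<eta>|, |\<xi> - \<eta>|, with \<eta> in the cone.
  Peetre's inequality 1 + x \<le> (1 + y)(1 + z) converts N powers from each factor into N powers of
  1 + x; p powers of 1 + y remain for summation.\<close>

lemma peetre_near:
  fixes x y z :: real
  assumes "x \<ge> 0" "y \<ge> 0" "z \<ge> 0" "x \<le> y + z" "u \<le> A / (1 + z) ^ N" "v \<le> B / (1 + y) ^ (N + p)"
    "A \<ge> 0" "B \<ge> 0" "u \<ge> 0" "v \<ge> 0"
  shows "u * v \<le> A * B / (1 + x) ^ N * (1 / (1 + y) ^ p)"
proof -
  have "1 + x \<le> (1 + z) * (1 + y)"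
  proof -
    have "(1 + z) * (1 + y) = 1 + (y + z) + y * z" by (simp add: algebra_simps)
    moreover have "0 \<le> y * z" using assms by simp
    ultimately show ?thesis using assms(4) by linarith
  qed
  then have le: "(1 + x) ^ N \<le> ((1 + z) * (1 + y)) ^ N"
    using assms by (intro power_mono) auto
  have "u * v \<le> A / (1 + z) ^ N * (B / (1 + y) ^ (N + p))"
    using assms by (intro mult_mono) auto
  also have "\<dots> = A * B / ((1 + z) * (1 + y)) ^ N * (1 / (1 + y) ^ p)"
    by (simp add: power_add power_mult_distrib)
  also have "\<dots> \<le> A * B / (1 + x) ^ N * (1 / (1 + y) ^ p)"
    using assms le by (intro mult_right_mono divide_left_mono mult_pos_pos zero_less_power mult_nonneg_nonneg) auto
  finally show ?thesis .
qed

text \<open>The case of \<eta> outside the cone, where v only grows polynomially and u must supply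
  everything. N of its powers give decay in x through \<delta> (1 + x) \<le> 1 + z. Since \<delta>
  (1 + y) \<le> (1 + z)^2, each power of 1 + y costs two of 1 + z: k such powers cancel the growth
  of v and p are left for summation.\<close>

lemma peetre_far:
  fixes x y z \<delta> :: real
  assumes "x \<ge> 0" "y \<ge> 0" "z \<ge> 0" "y \<le> x + z" "\<delta> * x \<le> z" "0 < \<delta>" "\<delta> \<le> 1"
    "u \<le> A / (1 + z) ^ (N + 2 * (k + p))" "v \<le> B * (1 + y) ^ k"
    "A \<ge> 0" "B \<ge> 0" "u \<ge> 0" "v \<ge> 0"
  shows "u * v \<le> A * B / \<delta> ^ (N + (k + p)) / (1 + x) ^ N * (1 / (1 + y) ^ p)"
proof -
  have x: "\<delta> * (1 + x) \<le> 1 + z" using assms by (simp add: algebra_simps)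
  have "1 + y \<le> (1 + x) * (1 + z)"
  proof -
    have "(1 + x) * (1 + z) = 1 + (x + z) + x * z" by (simp add: algebra_simps)
    moreover have "0 \<le> x * z" using assms by simp
    ultimately show ?thesis using assms(4) by linarith
  qed
  then have "\<delta> * (1 + y) \<le> (\<delta> * (1 + x)) * (1 + z)"
    using assms by (simp add: mult.assoc)
  also have "\<dots> \<le> (1 + z) * (1 + z)"
    using x assms by (intro mult_right_mono) auto
  finally have y: "\<delta> * (1 + y) \<le> (1 + z) ^ 2" by (simp add: power2_eq_square)
  have "(\<delta> * (1 + x)) ^ N * (\<delta> * (1 + y)) ^ (k + p) \<le> (1 + z) ^ N * ((1 + z) ^ 2) ^ (k + p)"
    using x y assms by (intro mult_mono power_mono) auto
  also have "\<dots> = (1 + z) ^ (N + 2 * (k + p))" by (simp only: power_add power_mult)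
  finally have le: "\<delta> ^ (N + (k + p)) * (1 + x) ^ N * (1 + y) ^ (k + p) \<le> (1 + z) ^ (N + 2 * (k + p))"
    by (simp add: power_mult_distrib power_add mult_ac)
  have "u * v \<le> A / (1 + z) ^ (N + 2 * (k + p)) * (B * (1 + y) ^ k)"
    using assms by (intro mult_mono) auto
  also have "\<dots> = A * B * (1 + y) ^ k / (1 + z) ^ (N + 2 * (k + p))" by simp
  also have "\<dots> \<le> A * B * (1 + y) ^ k / (\<delta> ^ (N + (k + p)) * (1 + x) ^ N * (1 + y) ^ (k + p))"
    using assms le by (intro divide_left_mono mult_pos_pos zero_less_power mult_nonneg_nonneg zero_le_power) auto
  also have "\<dots> = A * B / \<delta> ^ (N + (k + p)) / (1 + x) ^ N * (1 / (1 + y) ^ p)"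
    using assms by (simp add: power_add)
  finally show ?thesis .
qed

lemma ft_modulate: "ft (\<lambda>x. \<theta> x * wave \<xi> x) \<eta> = ft \<theta> (\<xi> + \<eta>)"
  by (simp add: ft_def wave_add mult.assoc)

text \<open>The function w of \<open>distribution_fourier_bound\<close> is \<theta> times the wave
  of \<xi>, whose coefficient at a lattice frequency \<eta> is governed by \<open>ft\<close> of
  \<theta> at \<xi> - \<eta>. All constants are fixed before \<xi>, so the bound is uniform on the
  narrower cone.\<close>

theorem lattice_decay_imp_cone_decay:
  fixes f :: "'d::finite functional"
  assumes f: "distribution f" and \<psi>: "\<psi> \<in> test_functions (cube L a)"
    and \<theta>: "\<theta> \<in> test_functions (cube L a)" and L: "L > 0"
    and \<Gamma>: "open \<Gamma>" "positive_cone \<Gamma>" "\<xi>\<^sub>0 \<in> \<Gamma>"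
    and decay: "rapid_decay_on (\<Gamma> \<inter> (*\<^sub>R) (1 / L) ` integer_points) (\<lambda>\<eta>. f (\<lambda>x. \<psi> x * wave \<eta> x))"
  obtains \<Gamma>' where "open \<Gamma>'" "positive_cone \<Gamma>'" "\<xi>\<^sub>0 \<in> \<Gamma>'"
    "rapid_decay_on \<Gamma>' (\<lambda>\<xi>. f (\<lambda>x. \<psi> x * \<theta> x * wave \<xi> x))"
proof -
  obtain \<Gamma>' \<delta> where \<Gamma>': "open \<Gamma>'" "positive_cone \<Gamma>'" "\<xi>\<^sub>0 \<in> \<Gamma>'" and \<delta>: "0 < \<delta>" "\<delta> \<le> 1"
    and near: "\<And>\<xi> \<eta>. \<xi> \<in> \<Gamma>' \<Longrightarrow> norm (\<eta> - \<xi>) < \<delta> * norm \<xi> \<Longrightarrow> \<eta> \<in> \<Gamma>"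
    using shrink_cone[OF \<Gamma>] by blast
  let ?G = "\<lambda>\<eta>. norm (f (\<lambda>x. \<psi> x * wave \<eta> x))"
  let ?p = "2 * CARD('d)" and ?l = "\<lambda>n::real^'d. (1 / L) *\<^sub>R n" and ?V = "measure lborel (closed_cube L a)"
  obtain B k where B: "B \<ge> 0" "\<And>\<eta>. ?G \<eta> \<le> B * (1 + norm \<eta>) ^ k"
    using distribution_wave_bound[OF f \<psi>] by blast
  have "\<exists>C. \<forall>\<xi>\<in>\<Gamma>'. norm (f (\<lambda>x. \<psi> x * \<theta> x * wave \<xi> x)) \<le> C / (1 + norm \<xi>) ^ N" for N
  proof -
    obtain A1 where A1: "A1 \<ge> 0" "\<And>\<eta>. norm (ft \<theta> \<eta>) \<le> A1 / (1 + norm \<eta>) ^ N"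
      using ft_decay[OF \<theta>] by blast
    obtain A2 where A2: "A2 \<ge> 0" "\<And>\<eta>. norm (ft \<theta> \<eta>) \<le> A2 / (1 + norm \<eta>) ^ (N + 2 * (k + ?p))"
      using ft_decay[OF \<theta>] by blast
    obtain D where D: "D > 0" "\<And>\<eta>. \<eta> \<in> \<Gamma> \<inter> ?l ` integer_points \<Longrightarrow> ?G \<eta> \<le> D / (1 + norm \<eta>) ^ (N + ?p)"
      using rapid_decay_onE[OF decay] by blast
    \<comment> \<open>The maximum gives both cases the same majorant, whose dependence on \<eta> is
      a fixed summable factor.\<close>
    define K where "K = max (A1 * D) (A2 * B / \<delta> ^ (N + (k + ?p)))"
    let ?S = "\<Sum>\<^sub>\<infinity>n\<in>integer_points. 1 / (1 + norm (?l n)) ^ ?p"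
    have "norm (f (\<lambda>x. \<psi> x * \<theta> x * wave \<xi> x)) \<le> (K * ?S / ?V) / (1 + norm \<xi>) ^ N"
      if \<xi>: "\<xi> \<in> \<Gamma>'" for \<xi>
    proof -
      let ?H = "\<lambda>n. K / (1 + norm \<xi>) ^ N * (1 / (1 + norm (?l n)) ^ ?p)"
      have "norm (f (\<lambda>x. \<psi> x * (\<theta> x * wave \<xi> x))) \<le> infsum ?H integer_points / ?V"
      proof (rule distribution_fourier_bound[OF f \<psi> test_functions_mult_left[OF \<theta> smooth_wave] L])
        show "?H summable_on integer_points"
          by (intro summable_on_cmult_right summable_lattice L)
        fix n :: "real^'d" assume n: "n \<in> integer_points"
        define \<eta> where "\<eta> = ?l n"
        have \<eta>: "\<eta> \<in> ?l ` integer_points" using n by (auto simp: \<eta>_def)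
        have mono: "c / (1 + norm \<xi>) ^ N * (1 / (1 + norm \<eta>) ^ ?p) \<le> K / (1 + norm \<xi>) ^ N * (1 / (1 + norm \<eta>) ^ ?p)"
          if "c \<le> K" for c
          using that by (intro mult_right_mono divide_right_mono) auto
        have tri: "norm \<xi> \<le> norm \<eta> + norm (\<xi> - \<eta>)" "norm \<eta> \<le> norm \<xi> + norm (\<xi> - \<eta>)"
          using norm_triangle_sub[of \<xi> \<eta>] norm_triangle_sub[of \<eta> \<xi>] by (simp_all add: norm_minus_commute)
        have "norm (ft \<theta> (\<xi> - \<eta>)) * ?G \<eta> \<le> K / (1 + norm \<xi>) ^ N * (1 / (1 + norm \<eta>) ^ ?p)"
        proof (cases "\<eta> \<in> \<Gamma>")
          case True
          have "norm (ft \<theta> (\<xi> - \<eta>)) * ?G \<eta> \<le> A1 * D / (1 + norm \<xi>) ^ N * (1 / (1 + norm \<eta>) ^ ?p)"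
            using True \<eta> D tri A1 by (intro peetre_near[of _ _ "norm (\<xi> - \<eta>)"]) auto
          also note mono[of "A1 * D"]
          finally show ?thesis by (simp add: K_def)
        next
          case False
          \<comment> \<open>If \<eta> were closer to \<xi> than this, \<open>near\<close> would
            place it in \<Gamma>.\<close>
          then have "\<delta> * norm \<xi> \<le> norm (\<xi> - \<eta>)"
            using near[OF \<xi>, of \<eta>] by (auto simp: norm_minus_commute not_less[symmetric])
          then have "norm (ft \<theta> (\<xi> - \<eta>)) * ?G \<eta> \<le>
              A2 * B / \<delta> ^ (N + (k + ?p)) / (1 + norm \<xi>) ^ N * (1 / (1 + norm \<eta>) ^ ?p)"
            using tri A2 B \<delta> by (intro peetre_far[of _ _ "norm (\<xi> - \<eta>)"]) auto
          also note mono[of "A2 * B / \<delta> ^ (N + (k + ?p))"]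
          finally show ?thesis by (simp add: K_def)
        qed
        then show "norm (ft (\<lambda>x. \<theta> x * wave \<xi> x) (- ?l n)) * ?G (?l n) \<le> ?H n"
          by (simp only: ft_modulate \<eta>_def diff_conv_add_uminus)
      qed
      also have "infsum ?H integer_points = K / (1 + norm \<xi>) ^ N * ?S"
        by (intro infsum_cmult_right summable_lattice L)
      also have "K / (1 + norm \<xi>) ^ N * ?S / ?V = K * ?S / ?V / (1 + norm \<xi>) ^ N"
        by (simp add: mult.commute)
      finally show ?thesis by (simp only: mult.assoc)
    qed
    then show ?thesis by blast
  qed
  then have "rapid_decay_on \<Gamma>' (\<lambda>\<xi>. f (\<lambda>x. \<psi> x * \<theta> x * wave \<xi> x))"
    unfolding rapid_decay_on_def by blast
  with \<Gamma>' show thesis by (rule that)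
qed

section \<open>The equivalence\<close>

lemma open_cube: "open (cube L a)"
proof -
  have "cube L a = box (a - (\<chi> j. L / 2)) (a + (\<chi> j. L / 2))"
    by (auto simp: cube_def mem_box_cart)
  then show ?thesis by (simp only: open_box)
qed

lemma bounded_subset_cube:
  fixes K :: "(real^'d::finite) set"
  assumes "bounded K"
  obtains L where "L \<ge> 1" "K \<subseteq> cube L a"
proof -
  have "bounded ((\<lambda>x. x - a) ` K)"
    using assms by (rule bounded_translation_minus)
  then obtain r where r: "r > 0" "\<And>x. x \<in> K \<Longrightarrow> norm (x - a) \<le> r"
    unfolding bounded_pos by blast
  show thesis
  proof
    show "1 \<le> 2 * r + 1" using r by simp
    show "K \<subseteq> cube (2 * r + 1) a"
    proof
      fix x assume "x \<in> K"
      then have le: "\<bar>x $ j - a $ j\<bar> \<le> r" for j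
        using r(2) component_le_norm_cart[of "x - a" j] by fastforce
      have "r < (2 * r + 1) / 2" by simp
      from le_less_trans[OF le this] show "x \<in> cube (2 * r + 1) a"
        unfolding mem_cube by blast
    qed
  qed
qed

theorem theorem2p1:
  fixes f :: "'d::finite functional" and x\<^sub>0 \<xi>\<^sub>0 :: "real^'d"
  assumes "distribution f" and "\<xi>\<^sub>0 \<noteq> 0"
  shows "(\<exists>\<epsilon> \<phi> \<Gamma>. \<epsilon> \<in> {0<..<1} \<and> \<phi> \<in> test_functions (cube \<epsilon> x\<^sub>0) \<and>
             (\<forall>\<^sub>F x in nhds x\<^sub>0. \<phi> x = 1) \<and>
             open \<Gamma> \<and> positive_cone \<Gamma> \<and> \<xi>\<^sub>0 \<in> \<Gamma> \<and>
             (\<forall>N::nat. \<exists>C>0. \<forall>n \<in> \<Gamma> \<inter> integer_points.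
                norm (fourier (mult_distr f \<phi>) n) \<le> C * bracket n powr (- real N)))
         \<longleftrightarrow> (x\<^sub>0, \<xi>\<^sub>0) \<notin> WF f"
    (is "?lhs \<longleftrightarrow> ?rhs")
proof
  assume ?lhs
  then obtain \<epsilon> \<phi> \<Gamma> where \<epsilon>: "\<epsilon> \<in> {0<..<1}" and \<phi>: "\<phi> \<in> test_functions (cube \<epsilon> x\<^sub>0)"
    and one: "\<forall>\<^sub>F x in nhds x\<^sub>0. \<phi> x = 1" and \<Gamma>: "open \<Gamma>" "positive_cone \<Gamma>" "\<xi>\<^sub>0 \<in> \<Gamma>"
    and le: "\<And>N::nat. \<exists>C>0. \<forall>n \<in> \<Gamma> \<inter> integer_points.
                norm (fourier (mult_distr f \<phi>) n) \<le> C * bracket n powr (- real N)" by blast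
  note ft_eq = fourier_mult_distr[OF assms(1) test_functions_UNIV[OF \<phi>]]
  \<comment> \<open>Passing to side 1 makes the frequency lattice that of the integer points, and
    leaves room around the support of \<phi> for \<theta>.\<close>
  have "cube \<epsilon> x\<^sub>0 \<subseteq> cube 1 x\<^sub>0"
  proof
    fix x assume x: "x \<in> cube \<epsilon> x\<^sub>0"
    have "\<bar>x $ j - x\<^sub>0 $ j\<bar> < 1 / 2" for j
    proof -
      have "\<bar>x $ j - x\<^sub>0 $ j\<bar> < \<epsilon> / 2" using x unfolding mem_cube by blast
      then show ?thesis using \<epsilon> by simp
    qed
    then show "x \<in> cube 1 x\<^sub>0" unfolding mem_cube by simp
  qed
  then have \<phi>1: "\<phi> \<in> test_functions (cube 1 x\<^sub>0)" by (rule test_functions_mono[OF \<phi>])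
  obtain \<theta> V where \<theta>: "\<theta> \<in> test_functions (cube 1 x\<^sub>0)" "fun_support \<phi> \<subseteq> V" "\<And>x. x \<in> V \<Longrightarrow> \<theta> x = 1"
    by (rule test_function_bump[OF test_functions_compact[OF \<phi>1] open_cube test_functions_support[OF \<phi>1]]) blast
  \<comment> \<open>Multiplication by \<theta> leaves f \<phi> unchanged, so the decay obtained for
    f \<phi> \<theta> concerns the original cutoff, which then witnesses \<open>WF\<close>
    directly.\<close>
  have \<phi>\<theta>: "\<phi> x * \<theta> x = \<phi> x" for x
    using \<theta>(2,3) not_in_fun_support[of x \<phi>] by (cases "x \<in> fun_support \<phi>") auto
  have "rapid_decay_on (\<Gamma> \<inter> integer_points) (fourier (mult_distr f \<phi>))"
    by (rule rapid_decay_onI) (rule le)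
  then have "rapid_decay_on (\<Gamma> \<inter> (*\<^sub>R) (1 / 1) ` integer_points) (\<lambda>\<eta>. f (\<lambda>x. \<phi> x * wave \<eta> x))"
    by (simp add: ft_eq[abs_def] image_def)
  from lattice_decay_imp_cone_decay[OF assms(1) \<phi>1 \<theta>(1) zero_less_one \<Gamma> this]
  obtain \<Gamma>' where \<Gamma>': "open \<Gamma>'" "positive_cone \<Gamma>'" "\<xi>\<^sub>0 \<in> \<Gamma>'"
    and "rapid_decay_on \<Gamma>' (\<lambda>\<xi>. f (\<lambda>x. \<phi> x * \<theta> x * wave \<xi> x))" by blast
  then have "rapid_decay_on \<Gamma>' (fourier (mult_distr f \<phi>))"
    by (simp add: ft_eq[abs_def] \<phi>\<theta>)
  from rapid_decay_on_bracket[OF this] show ?rhs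
    unfolding WF_def using test_functions_UNIV[OF \<phi>] one \<Gamma>' by blast
next
  assume ?rhs
  then obtain \<psi> \<Gamma> where \<psi>: "\<psi> \<in> test_functions UNIV" and one: "\<forall>\<^sub>F x in nhds x\<^sub>0. \<psi> x = 1"
    and \<Gamma>: "open \<Gamma>" "positive_cone \<Gamma>" "\<xi>\<^sub>0 \<in> \<Gamma>"
    and le: "\<And>N::real. N > 0 \<Longrightarrow> \<exists>C>0. \<forall>\<xi>\<in>\<Gamma>. norm (fourier (mult_distr f \<psi>) \<xi>) \<le> C * bracket \<xi> powr (- N)"
    unfolding WF_def using assms(2) by blast
  obtain V where V: "open V" "x\<^sub>0 \<in> V" "\<And>x. x \<in> V \<Longrightarrow> \<psi> x = 1"
    using one unfolding eventually_nhds by blast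
  have "x\<^sub>0 \<in> V \<inter> cube (1 / 2) x\<^sub>0" using V by (simp add: mem_cube)
  then obtain \<phi> W where \<phi>: "\<phi> \<in> test_functions (V \<inter> cube (1 / 2) x\<^sub>0)"
    and W: "open W" "x\<^sub>0 \<in> W" "\<And>x. x \<in> W \<Longrightarrow> \<phi> x = 1"
    by (rule test_function_bump_at[OF open_Int[OF V(1) open_cube]]) blast
  have \<phi>c: "\<phi> \<in> test_functions (cube (1 / 2) x\<^sub>0)" by (rule test_functions_mono[OF \<phi>]) auto
  \<comment> \<open>\<phi> is supported where \<psi> = 1, so f \<psi> \<phi> is just f localized by
    \<phi>.\<close>
  have \<psi>\<phi>: "\<psi> x * \<phi> x = \<phi> x" for x
    using V(3) test_functions_support[OF \<phi>] not_in_fun_support[of x \<phi>]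
    by (cases "x \<in> fun_support \<phi>") auto
  \<comment> \<open>One cube has to contain both supports; its side may exceed 1 because \<psi> is
    an arbitrary cutoff. Decay on the lattice of spacing 1/L is available since it is known on all
    of \<Gamma>.\<close>
  obtain L where L: "L \<ge> 1" "fun_support \<psi> \<union> fun_support \<phi> \<subseteq> cube L x\<^sub>0"
    by (rule bounded_subset_cube[OF compact_imp_bounded[OF
          compact_Un[OF test_functions_compact[OF \<psi>] test_functions_compact[OF \<phi>]]]])
  have \<psi>L: "\<psi> \<in> test_functions (cube L x\<^sub>0)" and \<phi>L: "\<phi> \<in> test_functions (cube L x\<^sub>0)"
    using L \<psi> \<phi> by (auto simp: test_functions_def)
  have "rapid_decay_on \<Gamma> (fourier (mult_distr f \<psi>))"
    by (rule rapid_decay_onI) (rule le, simp)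
  then have "rapid_decay_on \<Gamma> (\<lambda>\<eta>. f (\<lambda>x. \<psi> x * wave \<eta> x))"
    by (simp add: fourier_mult_distr[OF assms(1) \<psi>, abs_def])
  then have "rapid_decay_on (\<Gamma> \<inter> (*\<^sub>R) (1 / L) ` integer_points) (\<lambda>\<eta>. f (\<lambda>x. \<psi> x * wave \<eta> x))"
    by (rule rapid_decay_on_subset) auto
  moreover have "L > 0" using L by simp
  ultimately obtain \<Gamma>' where \<Gamma>': "open \<Gamma>'" "positive_cone \<Gamma>'" "\<xi>\<^sub>0 \<in> \<Gamma>'"
    and "rapid_decay_on \<Gamma>' (\<lambda>\<xi>. f (\<lambda>x. \<psi> x * \<phi> x * wave \<xi> x))"
    using lattice_decay_imp_cone_decay[OF assms(1) \<psi>L \<phi>L _ \<Gamma>] by blast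
  then have "rapid_decay_on \<Gamma>' (fourier (mult_distr f \<phi>))"
    by (simp add: fourier_mult_distr[OF assms(1) test_functions_UNIV[OF \<phi>], abs_def] \<psi>\<phi>)
  then have "rapid_decay_on (\<Gamma>' \<inter> integer_points) (fourier (mult_distr f \<phi>))"
    by (rule rapid_decay_on_subset) auto
  from rapid_decay_on_bracket[OF this]
  have "\<forall>N::nat. \<exists>C>0. \<forall>n \<in> \<Gamma>' \<inter> integer_points.
      norm (fourier (mult_distr f \<phi>) n) \<le> C * bracket n powr (- real N)" by blast
  moreover have "\<forall>\<^sub>F x in nhds x\<^sub>0. \<phi> x = 1"
    using W unfolding eventually_nhds by blast
  moreover have "(1 / 2 :: real) \<in> {0<..<1}" by simp
  ultimately show ?lhs using \<phi>c \<Gamma>' by blast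
qed

end
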